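(* Let $G$ be a periodic group such that (i) the set of primes dividing the orders of elements of $G$ is exactly $\{2,3\}$, and (ii) for any two elements $g,h\in G$ whose orders are at most $4$, the order of $gh$ is at most $9$. Suppose moreover that the centralizer in $G$ of every involution of $G$ is a locally cyclic $2$-group. Then $G=O_{3}(G)\rtimes C$, where $O_{3}(G)$ is an abelian subgroup of exponent at most $9$ and $C$ is a locally cyclic $2$-group acting regularly (fixed-point-freely) on $O_{3}(G)$. In particular, $G$ is locally finite.
   Context: $O_3(G)$ denotes the largest normal $3$-subgroup of $G$. "$C$ acts regularly on $O_3(G)$" means that every nontrivial element of $C$ fixes only the identity of $O_3(G)$ under conjugation. *)

theory Defs
  imports "HOL-Algebra.Algebra" "HOL-Computational_Algebra.Primes"
begin

text \<open>Every element has finite order (group.ord is 0 exactly for elements of infinite order).\<close>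
definition periodic_group :: "('a, 'b) monoid_scheme \<Rightarrow> bool" where
  "periodic_group G \<longleftrightarrow> (\<forall>g \<in> carrier G. group.ord G g \<noteq> 0)"

definition element_order_primes :: "('a, 'b) monoid_scheme \<Rightarrow> nat set" where
  "element_order_primes G = {p. Factorial_Ring.prime p \<and> (\<exists>g \<in> carrier G. p dvd group.ord G g)}"

definition is_p_set :: "('a, 'b) monoid_scheme \<Rightarrow> nat \<Rightarrow> 'a set \<Rightarrow> bool" where
  "is_p_set G p H \<longleftrightarrow> (\<forall>h \<in> H. \<exists>k::nat. group.ord G h = p ^ k)"

definition p_subgroup :: "('a, 'b) monoid_scheme \<Rightarrow> nat \<Rightarrow> 'a set \<Rightarrow> bool" where
  "p_subgroup G p H \<longleftrightarrow> subgroup H G \<and> is_p_set G p H"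

definition locally_cyclic :: "('a, 'b) monoid_scheme \<Rightarrow> 'a set \<Rightarrow> bool" where
  "locally_cyclic G H \<longleftrightarrow> subgroup H G \<and>
     (\<forall>F. finite F \<and> F \<subseteq> H \<longrightarrow> (\<exists>a \<in> H. generate G F = generate G {a}))"

definition centralizer :: "('a, 'b) monoid_scheme \<Rightarrow> 'a \<Rightarrow> 'a set" where
  "centralizer G x = {g \<in> carrier G. g \<otimes>\<^bsub>G\<^esub> x = x \<otimes>\<^bsub>G\<^esub> g}"

definition involution :: "('a, 'b) monoid_scheme \<Rightarrow> 'a \<Rightarrow> bool" where
  "involution G t \<longleftrightarrow> t \<in> carrier G \<and> group.ord G t = 2"

definition is_O_p :: "('a, 'b) monoid_scheme \<Rightarrow> nat \<Rightarrow> 'a set \<Rightarrow> bool" where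
  "is_O_p G p N \<longleftrightarrow> N \<lhd> G \<and> is_p_set G p N \<and>
     (\<forall>H. H \<lhd> G \<and> is_p_set G p H \<longrightarrow> H \<subseteq> N)"

definition locally_finite_group :: "('a, 'b) monoid_scheme \<Rightarrow> bool" where
  "locally_finite_group G \<longleftrightarrow> (\<forall>F. finite F \<and> F \<subseteq> carrier G \<longrightarrow> finite (generate G F))"

end

theory Submission
  imports Defs
begin

text \<open>
  Two involutions never commute, since the centralizer of an involution is locally cyclic; hence
  the product of two involutions has order dividing 9 and, for a fixed involution \<open>a\<close>, every element
  is \<open>c h\<close> with \<open>c\<close> centralizing \<open>a\<close> and \<open>h\<close> inverted by \<open>a\<close>. The whole theorem follows once
  products of three involutions are involutions: then the products of two involutions form a
  subgroup inverted by every involution, which is the desired abelian complement of the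
  centralizer of \<open>a\<close>. If \<open>a\<close> is not a square, its centralizer is \<open>{1, a}\<close>, so that every element of
  odd order is inverted by \<open>a\<close>. If \<open>a = v\<^sup>2\<close>, then each \<open>h\<close> inverted by \<open>a\<close> commutes with its conjugate
  under \<open>v\<close>, so the conjugates of \<open>v\<close> multiply as in a Frobenius group with complement of order 4:
  a product of two of them is an involution, and \<open>v\<close> times an involution is a conjugate of \<open>v\<^sup>-\<^sup>1\<close>.
  The commutation is reduced to \<open>h\<close> of order 3, where the bound 9 on orders leaves only a
  quotient of \<open>PSL\<^sub>2(17)\<close> to be excluded.
\<close>

section \<open>Words in groups\<close>

context group
begin

lemma inv_cancel_left: "x \<in> carrier G \<Longrightarrow> y \<in> carrier G \<Longrightarrow> inv x \<otimes> (x \<otimes> y) = y"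
  and cancel_inv_left: "x \<in> carrier G \<Longrightarrow> y \<in> carrier G \<Longrightarrow> x \<otimes> (inv x \<otimes> y) = y"
  by (simp_all flip: m_assoc)

lemmas word_simps = m_assoc inv_mult_group inv_cancel_left cancel_inv_left

lemma involution_iff:
  "involution G t \<longleftrightarrow> t \<in> carrier G \<and> t \<otimes> t = \<one> \<and> t \<noteq> \<one>"
proof -
  have "ord t = 2 \<longleftrightarrow> t \<otimes> t = \<one> \<and> t \<noteq> \<one>" if t: "t \<in> carrier G"
  proof
    assume o: "ord t = 2"
    then have "t [^] (2::nat) = \<one>"
      using t by (metis pow_ord_eq_1)
    moreover have "t \<noteq> \<one>"
      using o by auto
    ultimately show "t \<otimes> t = \<one> \<and> t \<noteq> \<one>"
      using t by (simp add: numeral_2_eq_2)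
  next
    assume *: "t \<otimes> t = \<one> \<and> t \<noteq> \<one>"
    then have "ord t dvd 2"
      using t by (simp add: numeral_2_eq_2 flip: pow_eq_id)
    moreover have "ord t \<noteq> 1"
      using * ord_eq_1[OF t] by simp
    ultimately show "ord t = 2"
      using prime_nat_iff two_is_prime_nat by blast
  qed
  then show ?thesis
    unfolding involution_def by blast
qed

lemma involution_cancel:
  assumes "involution G t"
  shows "t \<in> carrier G" "t \<otimes> t = \<one>" "inv t = t" "y \<in> carrier G \<Longrightarrow> t \<otimes> (t \<otimes> y) = y"
  using assms by (auto simp: involution_iff inv_equality simp flip: m_assoc)

lemma involution_conj:
  assumes t: "involution G t" and g: "g \<in> carrier G"
  shows "involution G (inv g \<otimes> t \<otimes> g)"
proof -
  note [simp] = involution_cancel[OF t]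
  have "inv g \<otimes> t \<otimes> g \<noteq> \<one>"
  proof
    assume *: "inv g \<otimes> t \<otimes> g = \<one>"
    have "t = g \<otimes> (inv g \<otimes> t \<otimes> g) \<otimes> inv g"
      using g by (simp add: word_simps)
    then have "t = \<one>"
      unfolding * using g by simp
    then show False
      using t by (simp add: involution_iff)
  qed
  then show ?thesis
    using g by (simp add: involution_iff word_simps)
qed

lemma pow_conj:
  assumes "x \<in> carrier G" "g \<in> carrier G"
  shows "(inv g \<otimes> x \<otimes> g) [^] (n::nat) = inv g \<otimes> x [^] n \<otimes> g"
  using assms by (induction n) (simp_all add: word_simps)

lemma inverted_pow:
  assumes a: "involution G a" and x: "x \<in> carrier G" and "a \<otimes> x \<otimes> a = inv x"
  shows "a \<otimes> x [^] (n::nat) \<otimes> a = inv (x [^] n)"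
  using pow_conj[OF x, of a n] assms involution_cancel[OF a] by (simp add: nat_pow_inv)

text \<open>The square is \<open>(a \<otimes> x \<otimes> a) \<otimes> x = \<one>\<close>. If
  \<open>a \<otimes> x\<close> were trivial, then \<open>x = a\<close>, whose ninth power is
  \<open>a\<close> and not \<open>\<one>\<close>.\<close>

lemma involution_mult_inverted:
  assumes a: "involution G a" and x: "x \<in> carrier G" and i: "a \<otimes> x \<otimes> a = inv x"
    and odd: "x [^] (9::nat) = \<one>"
  shows "involution G (a \<otimes> x)"
proof -
  note [simp] = involution_cancel[OF a]
  have "a \<otimes> x \<otimes> (a \<otimes> x) = a \<otimes> x \<otimes> a \<otimes> x"
    using x by (simp add: m_assoc)
  also have "\<dots> = \<one>"
    unfolding i using x by simp
  finally have sq: "a \<otimes> x \<otimes> (a \<otimes> x) = \<one>" .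
  have "a \<otimes> x \<noteq> \<one>"
  proof
    assume "a \<otimes> x = \<one>"
    then have "x = a"
      using x by (metis involution_cancel(1,3)[OF a] inv_equality inv_inv inv_closed)
    then have "a [^] (9::nat) = \<one>"
      using odd by simp
    then have "a = \<one>"
      by (simp add: numeral_eq_Suc)
    then show False
      using a by (simp add: involution_iff)
  qed
  then show ?thesis
    using sq x by (simp add: involution_iff)
qed

lemma involution_prod_inverted:
  assumes "involution G s" "involution G t"
  shows "s \<otimes> (s \<otimes> t) \<otimes> s = inv (s \<otimes> t)" "t \<otimes> (s \<otimes> t) \<otimes> t = inv (s \<otimes> t)"
  using involution_cancel[OF assms(1)] involution_cancel[OF assms(2)]
  by (simp_all add: inv_mult_group m_assoc)

lemma commute_left:
  assumes "x \<otimes> y = y \<otimes> x" "x \<in> carrier G" "y \<in> carrier G" "z \<in> carrier G"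
  shows "x \<otimes> (y \<otimes> z) = y \<otimes> (x \<otimes> z)"
  using assms by (simp flip: m_assoc)

lemma commute_inv:
  assumes "x \<otimes> y = y \<otimes> x" "x \<in> carrier G" "y \<in> carrier G"
  shows "inv x \<otimes> y = y \<otimes> inv x"
proof -
  have "inv x \<otimes> (x \<otimes> y) \<otimes> inv x = inv x \<otimes> (y \<otimes> x) \<otimes> inv x"
    by (simp only: assms(1))
  then show ?thesis
    using assms(2,3) by (simp add: word_simps)
qed

lemma commute_conj:
  assumes "x \<otimes> y = y \<otimes> x" "x \<in> carrier G" "y \<in> carrier G" "g \<in> carrier G"
  shows "inv g \<otimes> x \<otimes> g \<otimes> (inv g \<otimes> y \<otimes> g) = inv g \<otimes> y \<otimes> g \<otimes> (inv g \<otimes> x \<otimes> g)"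
  using assms by (simp add: word_simps commute_left)

text \<open>Serves as rewrite rules that carry the involution towards the right end of a word,
  inverting each letter it passes.\<close>

lemma inverted_commute:
  assumes a: "involution G a" and x: "x \<in> carrier G" and i: "a \<otimes> x \<otimes> a = inv x"
  shows "a \<otimes> x = inv x \<otimes> a" "a \<otimes> inv x = x \<otimes> a"
    "y \<in> carrier G \<Longrightarrow> a \<otimes> (x \<otimes> y) = inv x \<otimes> (a \<otimes> y)"
    "y \<in> carrier G \<Longrightarrow> a \<otimes> (inv x \<otimes> y) = x \<otimes> (a \<otimes> y)"
proof -
  note [simp] = involution_cancel[OF a]
  have "a \<otimes> x = a \<otimes> x \<otimes> a \<otimes> a"
    using x by (simp add: m_assoc)
  then show 1: "a \<otimes> x = inv x \<otimes> a"
    by (simp only: i)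
  have "a \<otimes> inv x = a \<otimes> (a \<otimes> x \<otimes> a)"
    by (simp only: i)
  then show 2: "a \<otimes> inv x = x \<otimes> a"
    using x by (simp add: m_assoc)
  show "y \<in> carrier G \<Longrightarrow> a \<otimes> (x \<otimes> y) = inv x \<otimes> (a \<otimes> y)"
    "y \<in> carrier G \<Longrightarrow> a \<otimes> (inv x \<otimes> y) = x \<otimes> (a \<otimes> y)"
    using x 1 2 by (simp_all flip: m_assoc)
qed

lemma order_3_inv:
  assumes x: "x \<in> carrier G" and 3: "x [^] (3::nat) = \<one>"
  shows "x \<otimes> x = inv x" "inv x \<otimes> inv x = x"
    "y \<in> carrier G \<Longrightarrow> x \<otimes> (x \<otimes> y) = inv x \<otimes> y"
    "y \<in> carrier G \<Longrightarrow> inv x \<otimes> (inv x \<otimes> y) = x \<otimes> y"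
proof -
  show 1: "x \<otimes> x = inv x"
    using x 3 by (intro inv_equality[symmetric]) (simp_all add: numeral_3_eq_3)
  have "inv x \<otimes> inv x = inv (x \<otimes> x)"
    using x by (simp add: inv_mult_group)
  then show 2: "inv x \<otimes> inv x = x"
    using x by (simp add: 1)
  show "y \<in> carrier G \<Longrightarrow> x \<otimes> (x \<otimes> y) = inv x \<otimes> y"
    "y \<in> carrier G \<Longrightarrow> inv x \<otimes> (inv x \<otimes> y) = x \<otimes> y"
    using x 1 2 by (simp_all flip: m_assoc)
qed

lemma pow_coprime_one:
  assumes x: "x \<in> carrier G" and "x [^] (m::nat) = \<one>" "x [^] (n::nat) = \<one>" "coprime m n"
  shows "x = \<one>"
proof -
  have "ord x dvd m" "ord x dvd n"
    using assms by (simp_all flip: pow_eq_id)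
  then have "ord x = 1"
    using \<open>coprime m n\<close> coprime_common_divisor_nat by blast
  then show ?thesis
    using ord_eq_1[OF x] by simp
qed

lemma inv_cancel_right: "x \<in> carrier G \<Longrightarrow> y \<in> carrier G \<Longrightarrow> y \<otimes> inv x \<otimes> x = y"
  by (simp add: m_assoc)

lemma subgroup_set_mult:
  assumes H: "subgroup H G" and K: "subgroup K G"
    and conj: "\<And>h k. h \<in> H \<Longrightarrow> k \<in> K \<Longrightarrow> inv k \<otimes> h \<otimes> k \<in> H"
  shows "subgroup (H <#> K) G"
proof (rule subgroupI)
  note [simp] = subgroup.mem_carrier[OF H] subgroup.mem_carrier[OF K]
  show "H <#> K \<subseteq> carrier G"
    by (auto simp: set_mult_def)
  show "H <#> K \<noteq> {}"
    using subgroup.one_closed[OF H] subgroup.one_closed[OF K] by (auto simp: set_mult_def)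
  have conj': "k \<otimes> h \<otimes> inv k \<in> H" if "h \<in> H" "k \<in> K" for h k
    using conj[OF that(1) subgroup.m_inv_closed[OF K that(2)]] that by simp
  have mult: "h \<otimes> k \<in> H <#> K" if "h \<in> H" "k \<in> K" for h k
    using that by (auto simp: set_mult_def)
  fix x assume "x \<in> H <#> K"
  then obtain h k where x: "h \<in> H" "k \<in> K" "x = h \<otimes> k"
    by (auto simp: set_mult_def)
  have "inv x = (inv k \<otimes> inv h \<otimes> k) \<otimes> inv k"
    using x by (simp add: word_simps)
  then show "inv x \<in> H <#> K"
    using mult[OF conj[OF subgroup.m_inv_closed[OF H x(1)] x(2)] subgroup.m_inv_closed[OF K x(2)]] by simp
  fix y assume "y \<in> H <#> K"
  then obtain h' k' where y: "h' \<in> H" "k' \<in> K" "y = h' \<otimes> k'"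
    by (auto simp: set_mult_def)
  have "x \<otimes> y = (h \<otimes> (k \<otimes> h' \<otimes> inv k)) \<otimes> (k \<otimes> k')"
    using x y by (simp add: word_simps)
  then show "x \<otimes> y \<in> H <#> K"
    using mult[OF subgroup.m_closed[OF H x(1) conj'[OF y(1) x(2)]] subgroup.m_closed[OF K x(2) y(2)]] by simp
qed

lemma finite_set_mult: "finite H \<Longrightarrow> finite K \<Longrightarrow> finite (H <#> K)"
  by (simp add: set_mult_def)

lemma generate_conj_closed:
  assumes S: "S \<subseteq> carrier G" and g: "g \<in> carrier G"
    and conj: "\<And>s. s \<in> S \<Longrightarrow> inv g \<otimes> s \<otimes> g \<in> S" and x: "x \<in> generate G S"
  shows "inv g \<otimes> x \<otimes> g \<in> generate G S"
  using x
proof (induction rule: generate.induct)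
  case one
  then show ?case
    using g generate.one by simp
next
  case (incl s)
  then show ?case
    using conj by (intro generate.incl)
next
  case (inv s)
  have "inv g \<otimes> inv s \<otimes> g = inv (inv g \<otimes> s \<otimes> g)"
    using inv S g by (auto simp: word_simps)
  then show ?case
    using conj[OF inv] by (simp add: generate.inv)
next
  case (eng x y)
  have "inv g \<otimes> (x \<otimes> y) \<otimes> g = (inv g \<otimes> x \<otimes> g) \<otimes> (inv g \<otimes> y \<otimes> g)"
    using generate_in_carrier[OF S] eng g by (auto simp: word_simps)
  then show ?case
    using eng generate.eng by simp
qed

lemma ord_le_4I:
  assumes "x \<in> carrier G" "x [^] (n::nat) = \<one>" "0 < n" "n \<le> 4"
  shows "ord x \<le> 4"
proof -
  have "ord x dvd n"
    using assms by (simp flip: pow_eq_id)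
  then show ?thesis
    using assms by (meson dvd_imp_le le_trans)
qed

lemma ord_involution_le_4: "involution G t \<Longrightarrow> ord t \<le> 4"
  by (simp add: involution_def)

text \<open>The identity outside the carrier makes conjugation by a group element a permutation of
  the whole type, as \<open>PSL_2_17_relations_collapse\<close> requires. It is a right action, so
  composites reverse the order of factors.\<close>

definition conj_action :: "'a \<Rightarrow> 'a \<Rightarrow> 'a" where
  "conj_action g x = (if x \<in> carrier G then inv g \<otimes> x \<otimes> g else x)"

lemma conj_action_mult:
  "g \<in> carrier G \<Longrightarrow> h \<in> carrier G \<Longrightarrow> conj_action h \<circ> conj_action g = conj_action (g \<otimes> h)"
  by (auto simp: conj_action_def word_simps fun_eq_iff)

lemma conj_action_one: "conj_action \<one> = id"
  by (auto simp: conj_action_def fun_eq_iff)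

lemma conj_action_pow: "g \<in> carrier G \<Longrightarrow> conj_action g ^^ n = conj_action (g [^] n)"
  by (induction n) (simp_all add: conj_action_one conj_action_mult flip: nat_pow_Suc2)

lemma conj_action_fixes:
  "g \<in> carrier G \<Longrightarrow> x \<in> carrier G \<Longrightarrow> conj_action g x = x \<longleftrightarrow> g \<otimes> x = x \<otimes> g"
  unfolding conj_action_def by (simp add: m_assoc) (metis inv_solve_left m_closed)

end

section \<open>Orders and centralizers\<close>

locale two_three_group = group G for G (structure) +
  assumes periodic: "periodic_group G"
    and primes: "element_order_primes G = {2, 3}"
    and ord_prod: "\<forall>g \<in> carrier G. \<forall>h \<in> carrier G.
        group.ord G g \<le> 4 \<and> group.ord G h \<le> 4 \<longrightarrow> group.ord G (g \<otimes> h) \<le> 9"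
    and invol: "\<forall>t. involution G t \<longrightarrow>
        locally_cyclic G (centralizer G t) \<and> p_subgroup G 2 (centralizer G t)"
begin

lemma ord_pos: "x \<in> carrier G \<Longrightarrow> 0 < ord x"
  using periodic by (auto simp: periodic_group_def)

lemma centralizer_two_power:
  assumes "involution G a" "c \<in> carrier G" "c \<otimes> a = a \<otimes> c"
  shows "\<exists>k::nat. ord c = 2 ^ k"
  using invol assms by (auto simp: p_subgroup_def is_p_set_def centralizer_def)

text \<open>Local cyclicity applied to \<open>{x, y}\<close>; natural exponents suffice because the
  generator has finite order.\<close>

lemma centralizer_pair_cyclic:
  assumes a: "involution G a"
    and "x \<in> carrier G" "x \<otimes> a = a \<otimes> x" "y \<in> carrier G" "y \<otimes> a = a \<otimes> y"
  obtains d i j where "d \<in> carrier G" "d \<otimes> a = a \<otimes> d" "x = d [^] (i::nat)" "y = d [^] (j::nat)"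
proof -
  have "{x, y} \<subseteq> centralizer G a" "finite {x, y}"
    using assms by (auto simp: centralizer_def)
  then obtain d where d: "d \<in> centralizer G a" "generate G {x, y} = generate G {d}"
    using invol a unfolding locally_cyclic_def by meson
  have dG: "d \<in> carrier G"
    using d by (simp add: centralizer_def)
  have "x \<in> generate G {d}" "y \<in> generate G {d}"
    unfolding d(2)[symmetric] by (auto intro: generate.incl)
  then show ?thesis
    using that[OF dG] d dG ord_pos[OF dG] by (auto simp: generate_pow_nat centralizer_def)
qed

lemma centralizer_comm:
  assumes "involution G a"
    and "x \<in> carrier G" "x \<otimes> a = a \<otimes> x" "y \<in> carrier G" "y \<otimes> a = a \<otimes> y"
  shows "x \<otimes> y = y \<otimes> x"
  using centralizer_pair_cyclic[OF assms] by (metis nat_pow_mult add.commute)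

text \<open>A cyclic 2-group has a single involution. Both are powers of one \<open>d\<close> of
  order \<open>2 ^ k\<close>, with exponents odd multiples of \<open>2 ^ (k - 1)\<close>; the sum of
  these is divisible by \<open>2 ^ k\<close>, whence \<open>s \<otimes> a = \<one>\<close>.\<close>

lemma involution_unique:
  assumes a: "involution G a" and s: "involution G s" and comm: "s \<otimes> a = a \<otimes> s"
  shows "s = a"
proof -
  obtain d i j where d: "d \<in> carrier G" "d \<otimes> a = a \<otimes> d" "s = d [^] (i::nat)" "a = d [^] (j::nat)"
    by (rule centralizer_pair_cyclic[OF a, of s a]) (use comm involution_cancel[OF a] involution_cancel[OF s] in auto)
  obtain k where k: "ord d = 2 ^ k"
    using centralizer_two_power[OF a d(1,2)] by blast
  have key: "\<not> 2 ^ k dvd l \<and> 2 ^ k dvd 2 * l" if "involution G (d [^] l)" for l :: nat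
  proof -
    have "d [^] l \<noteq> \<one>" "d [^] l \<otimes> d [^] l = \<one>"
      using that by (auto simp: involution_iff)
    then show ?thesis
      using d(1) by (simp add: nat_pow_mult pow_eq_id k mult_2)
  qed
  have i: "\<not> 2 ^ k dvd i" "2 ^ k dvd 2 * i" and j: "\<not> 2 ^ k dvd j" "2 ^ k dvd 2 * j"
    using key s a d by auto
  have "k \<noteq> 0"
    using i by (metis one_dvd power_0)
  then obtain l where l: "k = Suc l"
    by (cases k) auto
  obtain i' j' where ij: "i = 2 ^ l * i'" "j = 2 ^ l * j'"
    using i(2) j(2) unfolding l by (auto elim!: dvdE)
  have "odd i'" "odd j'"
    using i(1) j(1) unfolding ij l by (auto simp: mult.commute)
  then have "even (i' + j')"
    by simp
  then have "2 ^ k dvd i + j"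
    unfolding ij l by (auto simp flip: distrib_left)
  then have "s \<otimes> a = \<one>"
    using d by (simp add: nat_pow_mult pow_eq_id k)
  then show ?thesis
    using involution_cancel[OF a] involution_cancel[OF s] by (metis inv_equality)
qed

section \<open>Orders of elements and of products\<close>

lemma involution_in_powers:
  assumes "c \<in> carrier G" "even (ord c)"
  shows "involution G (c [^] (ord c div 2))"
proof -
  have o: "0 < ord c"
    using assms ord_pos by blast
  have "\<not> ord c dvd ord c div 2"
    using assms o by (auto elim!: evenE dest: dvd_imp_le)
  moreover have "c [^] (ord c div 2) \<otimes> c [^] (ord c div 2) = \<one>"
    using assms by (simp add: nat_pow_mult flip: mult_2)
  ultimately show ?thesis
    using assms by (auto simp: involution_iff pow_eq_id)
qed

text \<open>An element of even order commutes with the involution among its powers, so it lies in a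
  2-group. For odd order, 3 is the only prime left.\<close>

lemma ord_cases:
  assumes "x \<in> carrier G"
  shows "(\<exists>k. ord x = 2 ^ k) \<or> (\<exists>k. ord x = 3 ^ k)"
proof (cases "even (ord x)")
  case True
  have "x \<otimes> x [^] (ord x div 2) = x [^] (ord x div 2) \<otimes> x"
    using assms by (metis nat_pow_Suc nat_pow_Suc2)
  then show ?thesis
    using centralizer_two_power[OF involution_in_powers[OF assms True] assms] by blast
next
  case False
  obtain r where r: "ord x = 3 ^ multiplicity 3 (ord x) * r" "\<not> 3 dvd r"
    by (rule multiplicity_decompose'[of "ord x" 3]) (use ord_pos[OF assms] in auto)
  have "r = 1"
  proof (rule ccontr)
    assume "r \<noteq> 1"
    then obtain p where p: "Factorial_Ring.prime p" "p dvd r"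
      by (metis prime_factor_nat)
    then have "p \<in> element_order_primes G"
      using assms r(1) by (auto simp: element_order_primes_def intro!: bexI[of _ x] dvd_trans[OF p(2)]) (metis dvd_triv_right)
    then have "p = 2 \<or> p = 3"
      by (simp add: primes)
    then show False
      using False r p by (metis dvd_mult)
  qed
  then show ?thesis
    using r by auto
qed

text \<open>The order is a power of 2 or of 3, and the largest such powers up to 9 are 8 and
  9.\<close>

lemma pow_8_or_9:
  assumes "g \<in> carrier G" "h \<in> carrier G" "ord g \<le> 4" "ord h \<le> 4"
  shows "(g \<otimes> h) [^] (8::nat) = \<one> \<or> (g \<otimes> h) [^] (9::nat) = \<one>"
proof -
  have gh: "g \<otimes> h \<in> carrier G"
    using assms by simp
  have le: "ord (g \<otimes> h) \<le> 9"
    using assms ord_prod by blast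
  have "2 ^ k dvd (2::nat) ^ 3" if "2 ^ k \<le> (9::nat)" for k :: nat
    using power_less_imp_less_exp[of "2::nat" k 4] that by (intro le_imp_power_dvd) simp
  moreover have "3 ^ k dvd (3::nat) ^ 2" if "3 ^ k \<le> (9::nat)" for k :: nat
    using power_less_imp_less_exp[of "3::nat" k 3] that by (intro le_imp_power_dvd) simp
  ultimately show ?thesis
    using ord_cases[OF gh] le gh by (auto simp: pow_eq_id)
qed

text \<open>Otherwise \<open>s \<otimes> t\<close> has even order and some power \<open>z\<close> of
  it is an involution. Both \<open>s\<close> and \<open>t\<close> invert
  \<open>s \<otimes> t\<close>, hence commute with \<open>z\<close>, so uniqueness gives
  \<open>s = z = t\<close>.\<close>

lemma involution_prod_pow_9:
  assumes s: "involution G s" and t: "involution G t"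
  shows "(s \<otimes> t) [^] (9::nat) = \<one>"
proof (cases "(s \<otimes> t) [^] (9::nat) = \<one>")
  case False
  note [simp] = involution_cancel[OF s] involution_cancel[OF t]
  let ?x = "s \<otimes> t"
  have x: "?x \<in> carrier G"
    by simp
  have "?x [^] (8::nat) = \<one>"
    using pow_8_or_9[of s t] ord_involution_le_4 s t False by auto
  then have "ord ?x dvd 2 ^ 3"
    using x by (simp flip: pow_eq_id)
  then obtain k where k: "ord ?x = 2 ^ k"
    using divides_primepow_nat two_is_prime_nat by blast
  have "k \<noteq> 0"
    using False x ord_eq_1[OF x] k by auto
  then have ev: "even (ord ?x)"
    by (simp add: k)
  define z where "z = ?x [^] (ord ?x div 2)"
  have z: "involution G z"
    unfolding z_def by (rule involution_in_powers[OF x ev])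
  note [simp] = involution_cancel[OF z]
  have "u \<otimes> z = z \<otimes> u" if u: "involution G u" and i: "u \<otimes> ?x \<otimes> u = inv ?x" for u
  proof -
    note [simp] = involution_cancel[OF u]
    have "u \<otimes> z \<otimes> u = inv z"
      unfolding z_def by (rule inverted_pow[OF u x i])
    then have "u \<otimes> z \<otimes> u \<otimes> u = z \<otimes> u"
      by simp
    then show ?thesis
      by (simp add: m_assoc)
  qed
  then have "s = z" "t = z"
    using involution_unique[OF z] s t involution_prod_inverted[OF s t] by blast+
  then show ?thesis
    by simp
qed

text \<open>Two elements of order 3 with an involution as product generate a copy of \<open>A\<^sub>4\<close>.\<close>
lemma no_alternating_group_4:
  assumes b: "b \<in> carrier G" "b [^] (3::nat) = \<one>" and c: "c \<in> carrier G" "c [^] (3::nat) = \<one>"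
    and bc: "(b \<otimes> c) [^] (2::nat) = \<one>"
  shows "b \<otimes> c = \<one>"
proof (rule ccontr)
  assume ne: "b \<otimes> c \<noteq> \<one>"
  define t where "t = b \<otimes> c"
  have t: "involution G t"
    using assms ne by (simp add: t_def involution_iff numeral_2_eq_2)
  note [simp] = involution_cancel[OF t]
  note [simp] = order_3_inv[OF b]
  have c_eq: "c = inv b \<otimes> t"
    using b c by (simp add: t_def word_simps)
  have "inv b \<otimes> t \<otimes> (inv b \<otimes> t) \<otimes> (inv b \<otimes> t) = \<one>"
    using c b by (simp add: numeral_3_eq_3 flip: c_eq)
  \<comment> \<open>Writing the middle \<open>inv b\<close> as \<open>b \<otimes> b\<close> makes
    two conjugates of \<open>t\<close> appear. The involution \<open>t\<close> is then a product of
    two involutions, so its ninth power would be trivial.\<close>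
  then have "(inv b \<otimes> t \<otimes> b \<otimes> (inv (inv b) \<otimes> t \<otimes> inv b)) \<otimes> t = \<one>"
    using b(1) by (simp add: m_assoc)
  then have "inv b \<otimes> t \<otimes> b \<otimes> (inv (inv b) \<otimes> t \<otimes> inv b) = t"
    using b(1) inv_equality[of "inv b \<otimes> t \<otimes> b \<otimes> (inv (inv b) \<otimes> t \<otimes> inv b)" t] by simp
  then have "t [^] (9::nat) = \<one>"
    using involution_prod_pow_9[OF involution_conj[OF t b(1)] involution_conj[OF t inv_closed[OF b(1)]]] by simp
  then have "t = \<one>"
    by (simp add: numeral_eq_Suc)
  then show False
    using ne t_def by simp
qed

text \<open>Since \<open>a\<close> and its conjugate \<open>t\<close> generate a dihedral group of order dividing 18, some
  power of \<open>t \<otimes> a\<close> conjugates \<open>a\<close> to \<open>t\<close>.\<close>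
lemma centralizer_inverted_decomposition:
  assumes a: "involution G a" and g: "g \<in> carrier G"
  defines "h \<equiv> (inv g \<otimes> a \<otimes> g \<otimes> a) [^] (4::nat)"
  shows "h \<in> carrier G" "a \<otimes> h \<otimes> a = inv h" "h [^] (9::nat) = \<one>"
    "g \<otimes> inv h \<otimes> a = a \<otimes> (g \<otimes> inv h)"
proof -
  define t where "t = inv g \<otimes> a \<otimes> g"
  have t: "involution G t"
    unfolding t_def by (rule involution_conj[OF a g])
  note [simp] = involution_cancel[OF a] involution_cancel[OF t]
  have h: "h = (t \<otimes> a) [^] (4::nat)"
    by (simp add: h_def t_def)
  show hG [simp]: "h \<in> carrier G"
    by (simp add: h)
  show i: "a \<otimes> h \<otimes> a = inv h"
    unfolding h by (rule inverted_pow[OF a _ involution_prod_inverted(2)[OF t a]]) simp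
  have m9: "(t \<otimes> a) [^] (9::nat) = \<one>"
    by (rule involution_prod_pow_9[OF t a])
  show "h [^] (9::nat) = \<one>"
  proof -
    have "h [^] (9::nat) = ((t \<otimes> a) [^] (9::nat)) [^] (4::nat)"
      by (simp add: h nat_pow_pow)
    then show ?thesis
      by (simp add: m9)
  qed
  note [simp] = inverted_commute[OF a hG i]
  \<comment> \<open>The exponent 4 makes \<open>h\<close> a square root of the inverse of
    \<open>t \<otimes> a\<close>, as 8 is -1 modulo 9. Hence \<open>t\<close> is the conjugate of
    \<open>a\<close> by \<open>h\<close> as well as by \<open>g\<close>.\<close>
  have "(h \<otimes> h \<otimes> t) \<otimes> a = h \<otimes> h \<otimes> (t \<otimes> a)"
    by (simp add: m_assoc)
  also have "\<dots> = \<one>"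
    unfolding h using m9 by (simp add: nat_pow_mult flip: nat_pow_Suc)
  finally have "h \<otimes> h \<otimes> t = a"
    using inv_equality[of "h \<otimes> h \<otimes> t" a] by simp
  then have t_eq: "t = inv h \<otimes> (inv h \<otimes> a)"
    by (auto simp: word_simps)
  have "t \<otimes> inv h = inv h \<otimes> a"
    by (simp add: t_eq word_simps)
  moreover have "a \<otimes> g = g \<otimes> t"
    using g by (simp add: t_def word_simps)
  then have "a \<otimes> (g \<otimes> inv h) = g \<otimes> (t \<otimes> inv h)"
    using g by (simp flip: m_assoc)
  ultimately show "g \<otimes> inv h \<otimes> a = a \<otimes> (g \<otimes> inv h)"
    using g by (simp add: m_assoc)
qed

text \<open>The involution among the powers of \<open>c\<close> commutes with \<open>a\<close>, so
  it is \<open>a\<close>. Whatever commutes with such a \<open>c\<close> therefore commutes with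
  \<open>a\<close>.\<close>

lemma centralizer_power_involution:
  assumes a: "involution G a" and c: "c \<in> carrier G" "c \<otimes> a = a \<otimes> c" "c \<noteq> \<one>"
  shows "\<exists>n::nat. c [^] n = a"
proof -
  obtain k where k: "ord c = 2 ^ k"
    using centralizer_two_power[OF a c(1,2)] by blast
  then have "k \<noteq> 0"
    using c ord_eq_1[OF c(1)] by auto
  then have ev: "even (ord c)"
    by (simp add: k)
  have "c [^] n \<otimes> a = a \<otimes> c [^] n" for n :: nat
    using c involution_cancel[OF a] by (induction n) (simp_all add: m_assoc, simp flip: m_assoc)
  then show ?thesis
    using involution_unique[OF a involution_in_powers[OF c(1) ev]] by blast
qed

text \<open>Both \<open>a\<close> and its conjugate by \<open>g\<close> invert \<open>r\<close>, so
  their product \<open>m\<close> commutes with \<open>r\<close>, and so do both factors of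
  \<open>g = ?c \<otimes> ?h\<close>. If \<open>?c\<close> were nontrivial, its power
  \<open>a\<close> would commute with \<open>r\<close>, which it inverts. So
  \<open>g = ?h\<close>.\<close>

lemma order_3_centralizer_inverted:
  assumes a: "involution G a" and r: "r \<in> carrier G" "r \<noteq> \<one>" "r [^] (3::nat) = \<one>"
    and i: "a \<otimes> r \<otimes> a = inv r"
    and g: "g \<in> carrier G" "g \<otimes> r = r \<otimes> g"
  shows "a \<otimes> g \<otimes> a = inv g"
proof -
  note [simp] = involution_cancel[OF a] inverted_commute[OF a r(1) i]
  define m where "m = inv g \<otimes> a \<otimes> g \<otimes> a"
  have m [simp]: "m \<in> carrier G"
    using g by (simp add: m_def)
  have gr: "g \<otimes> inv r = inv r \<otimes> g" "inv g \<otimes> r = r \<otimes> inv g"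
    using commute_inv[of r g] commute_inv[of g r] g r by auto
  have "m \<otimes> r = inv g \<otimes> (a \<otimes> (g \<otimes> inv r \<otimes> a))"
    using g r by (simp add: m_def m_assoc)
  also have "\<dots> = inv g \<otimes> r \<otimes> (a \<otimes> (g \<otimes> a))"
    using g r by (simp add: m_assoc commute_left[OF gr(1)])
  also have "\<dots> = r \<otimes> m"
    using g r by (simp add: m_def m_assoc commute_left[OF gr(2)])
  finally have mr: "m \<otimes> r = r \<otimes> m" .
  note dec = centralizer_inverted_decomposition[OF a g(1)]
  let ?h = "m [^] (4::nat)"
  let ?c = "g \<otimes> inv ?h"
  have "?h \<otimes> r = r \<otimes> ?h"
    using mr r by (simp add: group_commutes_pow)
  then have hr: "inv ?h \<otimes> r = r \<otimes> inv ?h"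
    using r by (intro commute_inv) auto
  have cr: "?c \<otimes> r = r \<otimes> ?c"
  proof -
    have "?c \<otimes> r = g \<otimes> (r \<otimes> inv ?h)"
      using g r hr by (simp add: m_assoc)
    then show ?thesis
      using g r by (simp add: m_assoc commute_left[OF g(2)])
  qed
  have "?c = \<one>"
  proof (rule ccontr)
    assume "?c \<noteq> \<one>"
    then obtain n where n: "?c [^] (n::nat) = a"
      using centralizer_power_involution[OF a, of ?c] dec(4) g by (auto simp: m_def)
    have "?c [^] n \<otimes> r = r \<otimes> ?c [^] n"
      using cr r g by (intro group_commutes_pow) auto
    then have "a \<otimes> r = r \<otimes> a"
      by (simp only: n)
    then have "inv r = r"
      using i r by (simp add: m_assoc)
    then have "r [^] (2::nat) = \<one>"
      using r by (simp add: numeral_2_eq_2) (metis l_inv)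
    then show False
      using pow_coprime_one[of r 2 3] r by simp
  qed
  then have "?c \<otimes> ?h = ?h"
    by simp
  then have "g = ?h"
    using g by (simp add: m_assoc)
  then show ?thesis
    using dec(2) by (simp add: m_def)
qed

text \<open>Inversion is compatible with the product only if
  \<open>inv g \<otimes> inv h = inv h \<otimes> inv g\<close>.\<close>

lemma comm_of_inverted:
  assumes a: "involution G a" and g: "g \<in> carrier G" "a \<otimes> g \<otimes> a = inv g"
    and h: "h \<in> carrier G" "a \<otimes> h \<otimes> a = inv h"
    and gh: "a \<otimes> (g \<otimes> h) \<otimes> a = inv (g \<otimes> h)"
  shows "g \<otimes> h = h \<otimes> g"
proof -
  note [simp] = involution_cancel[OF a] inverted_commute[OF a g] inverted_commute[OF a h]
  have "inv g \<otimes> inv h = a \<otimes> (g \<otimes> h) \<otimes> a"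
    using g(1) h(1) by (simp add: m_assoc)
  also have "\<dots> = inv h \<otimes> inv g"
    unfolding gh using g(1) h(1) by (simp add: inv_mult_group)
  finally have "inv (inv g \<otimes> inv h) = inv (inv h \<otimes> inv g)"
    by simp
  then show ?thesis
    using g(1) h(1) by (simp add: inv_mult_group)
qed

text \<open>The involution \<open>a\<close> inverts every element of the centralizer of
  \<open>r\<close>, including products.\<close>

lemma order_3_centralizer_comm:
  assumes a: "involution G a" and r: "r \<in> carrier G" "r \<noteq> \<one>" "r [^] (3::nat) = \<one>"
    and i: "a \<otimes> r \<otimes> a = inv r"
    and g: "g \<in> carrier G" "g \<otimes> r = r \<otimes> g" and h: "h \<in> carrier G" "h \<otimes> r = r \<otimes> h"
  shows "g \<otimes> h = h \<otimes> g"
proof (rule comm_of_inverted[OF a g(1) _ h(1)])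
  have "g \<otimes> h \<otimes> r = r \<otimes> (g \<otimes> h)"
    using g h r by (simp add: m_assoc commute_left[of g r])
  then show "a \<otimes> (g \<otimes> h) \<otimes> a = inv (g \<otimes> h)"
    using g h by (intro order_3_centralizer_inverted[OF a r i]) auto
qed (intro order_3_centralizer_inverted[OF a r i] g h)+

end

section \<open>A quotient of the projective special linear group over 17 elements\<close>

text \<open>
  The permutations \<open>m\<close> and \<open>w\<close>, composed from left to right, satisfy the relations
  \<open>m\<^sup>3 = w\<^sup>9 = (mw)\<^sup>4 = (m\<^sup>-\<^sup>1wmw)\<^sup>2 = 1\<close>, which define \<open>PSL\<^sub>2(17)\<close>; there \<open>mwmw\<^sup>3\<close>
  does not have order dividing 9, so the last relation collapses the group. The proof is a
  coset enumeration over \<open>\<langle>w\<rangle>\<close>, carried out inside the orbit of \<open>k\<close> and pruned to the points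
  that are needed: each step closes the cycle of one relation at one point, and the relation
  \<open>R5\<close>, applied once, sets off the coincidences \<open>e1, e2, \<dots>\<close> that end in \<open>m k = k\<close>.
\<close>
lemma PSL_2_17_relations_collapse:
  fixes m m' w w' :: "'b \<Rightarrow> 'b"
  assumes inverse: "\<And>x. m' (m x) = x" "\<And>x. m (m' x) = x" "\<And>x. w' (w x) = x" "\<And>x. w (w' x) = x"
    and R1: "\<And>x. m (m (m x)) = x"
    and w9: "\<And>x. (w ^^ 9) x = x"
    and wm4: "\<And>x. ((w \<circ> m) ^^ 4) x = x"
    and wmwm2: "\<And>x. ((w \<circ> m \<circ> w \<circ> m') ^^ 2) x = x"
    and www9: "\<And>x. ((w \<circ> w \<circ> w \<circ> m \<circ> w \<circ> m) ^^ 9) x = x"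
    and fixed: "w k = k"
  shows "m k = k"
proof -
  \<comment> \<open>These equivalences strip outer letters from a relation; when only one image
    along its cycle is unknown, what remains is that missing table entry.\<close>
  have peel: "m x = y \<longleftrightarrow> x = m' y" "m' x = y \<longleftrightarrow> x = m y" "w x = y \<longleftrightarrow> x = w' y" "w' x = y \<longleftrightarrow> x = w y" for x y
    using inverse by metis+
  note [simp] = inverse
  note unfold = eval_nat_numeral BitM.simps One_nat_def funpow.simps comp_apply id_apply
  note R2 = w9[unfolded unfold] and R3 = wm4[unfolded unfold]
    and R4 = wmwm2[unfolded unfold] and R5 = www9[unfolded unfold]
  have [simp]: "w k = k" "w' k = k"
    using fixed by (simp_all add: peel)
  \<comment> \<open>Blocks of this form only name new points: reflexivity fixes the names, and the
    entries join the simplifier.\<close>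
  obtain k1 k2 where [simp]: "m' k = k1" "m k1 = k" "m' k1 = k2" "m k2 = k1"
    by (rule that; rule refl inverse)
  have [simp]: "m k = k2" "m' k2 = k"
    using R1[of k] by (simp_all add: peel)
  obtain k3 k4 k5 k6 where [simp]:
    "w k2 = k3" "w' k3 = k2" "w' k2 = k4" "w k4 = k2"
    "m k4 = k5" "m' k5 = k4" "w k5 = k6" "w' k6 = k5"
    by (rule that; rule refl inverse)
  obtain k7 k8 k9 k10 where [simp]:
    "m k6 = k7" "m' k7 = k6" "w' k5 = k8" "w k8 = k5"
    "w' k8 = k9" "w k9 = k8" "w' k9 = k10" "w k10 = k9"
    by (rule that; rule refl inverse)
  obtain k11 k12 k13 k14 where [simp]:
    "w' k10 = k11" "w k11 = k10" "m k11 = k12" "m' k12 = k11"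
    "w' k7 = k13" "w k13 = k7" "w' k13 = k14" "w k14 = k13"
    by (rule that; rule refl inverse)
  obtain k15 k16 k17 k18 where [simp]:
    "w' k14 = k15" "w k15 = k14" "w' k15 = k16" "w k16 = k15"
    "m' k8 = k17" "m k17 = k8" "m' k17 = k18" "m k18 = k17"
    by (rule that; rule refl inverse)
  have [simp]: "m k8 = k18" "m' k18 = k8"
    using R1[of k8] by (simp_all add: peel)
  obtain k19 k20 k21 where [simp]:
    "w' k12 = k19" "w k19 = k12" "w' k18 = k20" "w k20 = k18"
    "m k5 = k21" "m' k21 = k5"
    by (rule that; rule refl inverse)
  have [simp]: "m k21 = k4" "m' k4 = k21"
    using R1[of k4] by (simp_all add: peel)
  obtain k22 k23 k24 where [simp]:
    "w k21 = k22" "w' k22 = k21" "m k22 = k23" "m' k23 = k22"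
    "m k23 = k24" "m' k24 = k23"
    by (rule that; rule refl inverse)
  have [simp]: "m k24 = k22" "m' k22 = k24"
    using R1[of k22] by (simp_all add: peel)
  obtain k25 k26 k27 k28 where [simp]:
    "w' k24 = k25" "w k25 = k24" "m k25 = k26" "m' k26 = k25"
    "w' k26 = k27" "w k27 = k26" "m' k27 = k28" "m k28 = k27"
    by (rule that; rule refl inverse)
  obtain k29 k30 k31 k32 where [simp]:
    "w' k28 = k29" "w k29 = k28" "w' k29 = k30" "w k30 = k29"
    "m k30 = k31" "m' k31 = k30" "m k27 = k32" "m' k32 = k27"
    by (rule that; rule refl inverse)
  have [simp]: "m k32 = k28" "m' k28 = k32"
    using R1[of k27] by (simp_all add: peel)
  obtain k33 k34 k35 where [simp]:
    "w' k23 = k33" "w k33 = k23" "m k3 = k34" "m' k34 = k3"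
    "m k34 = k35" "m' k35 = k34"
    by (rule that; rule refl inverse)
  have [simp]: "m k35 = k3" "m' k3 = k35"
    using R1[of k35] by (simp_all add: peel)
  have [simp]: "w k35 = k21" "w' k21 = k35"
    using R4[of k3] by (simp_all add: peel)
  obtain k36 k37 k38 k39 where [simp]:
    "m' k19 = k36" "m k36 = k19" "w k17 = k37" "w' k37 = k17"
    "m k33 = k38" "m' k38 = k33" "w' k38 = k39" "w k39 = k38"
    by (rule that; rule refl inverse)
  obtain k40 k41 k42 where [simp]:
    "w' k4 = k40" "w k40 = k4" "m k40 = k41" "m' k41 = k40"
    "w k22 = k42" "w' k42 = k22"
    by (rule that; rule refl inverse)
  have [simp]: "m' k42 = k29" "m k29 = k42"
    using R4[of k26] by (simp_all add: peel)
  obtain k43 k44 k45 where [simp]: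
    "w k42 = k43" "w' k43 = k42" "m' k43 = k44" "m k44 = k43"
    "m' k44 = k45" "m k45 = k44"
    by (rule that; rule refl inverse)
  have [simp]: "m k43 = k45" "m' k45 = k43"
    using R1[of k43] by (simp_all add: peel)
  obtain k46 where [simp]: "m k41 = k46" "m' k46 = k41"
    by (rule that; rule refl inverse)
  have [simp]: "m k46 = k40" "m' k40 = k46"
    using R1[of k40] by (simp_all add: peel)
  obtain k47 k48 k49 where [simp]:
    "w k46 = k47" "w' k47 = k46" "w k47 = k48" "w' k48 = k47"
    "m k12 = k49" "m' k49 = k12"
    by (rule that; rule refl inverse)
  have [simp]: "m k49 = k11" "m' k11 = k49"
    using R1[of k11] by (simp_all add: peel)
  obtain k50 k51 where [simp]: "m k48 = k50" "m' k50 = k48" "m k50 = k51" "m' k51 = k50"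
    by (rule that; rule refl inverse)
  have [simp]: "m k51 = k48" "m' k48 = k51"
    using R1[of k48] by (simp_all add: peel)
  obtain k52 k53 k54 k55 where [simp]:
    "m' k47 = k52" "m k52 = k47" "w k52 = k53" "w' k53 = k52"
    "w' k50 = k54" "w k54 = k50" "w' k54 = k55" "w k55 = k54"
    by (rule that; rule refl inverse)
  obtain k56 k57 k58 where [simp]:
    "w k41 = k56" "w' k56 = k41" "m' k56 = k57" "m k57 = k56"
    "m' k57 = k58" "m k58 = k57"
    by (rule that; rule refl inverse)
  have [simp]: "m k56 = k58" "m' k58 = k56"
    using R1[of k56] by (simp_all add: peel)
  obtain k59 k60 k61 k62 where [simp]:
    "w' k58 = k59" "w k59 = k58" "m k59 = k60" "m' k60 = k59"
    "w' k60 = k61" "w k61 = k60" "m' k61 = k62" "m k62 = k61"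
    by (rule that; rule refl inverse)
  obtain k63 k64 k65 k66 where [simp]:
    "m' k53 = k63" "m k63 = k53" "w' k32 = k64" "w k64 = k32"
    "m' k64 = k65" "m k65 = k64" "m k55 = k66" "m' k66 = k55"
    by (rule that; rule refl inverse)
  obtain k67 k68 k69 k70 where [simp]:
    "m' k14 = k67" "m k67 = k14" "w' k34 = k68" "w k68 = k34"
    "m k16 = k69" "m' k69 = k16" "m k69 = k70" "m' k70 = k69"
    by (rule that; rule refl inverse)
  have [simp]: "m k70 = k16" "m' k16 = k70"
    using R1[of k70] by (simp_all add: peel)
  obtain k71 k72 k73 where [simp]:
    "w k66 = k71" "w' k71 = k66" "m' k71 = k72" "m k72 = k71"
    "m k71 = k73" "m' k73 = k71"
    by (rule that; rule refl inverse)
  have [simp]: "m k73 = k72" "m' k72 = k73"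
    using R1[of k71] by (simp_all add: peel)
  obtain k74 k75 k76 k77 where [simp]:
    "w k37 = k74" "w' k74 = k37" "m k74 = k75" "m' k75 = k74"
    "w' k41 = k76" "w k76 = k41" "m k76 = k77" "m' k77 = k76"
    by (rule that; rule refl inverse)
  obtain k78 k79 k80 k81 where [simp]:
    "w k70 = k78" "w' k78 = k70" "m k78 = k79" "m' k79 = k78"
    "m' k54 = k80" "m k80 = k54" "m' k80 = k81" "m k81 = k80"
    by (rule that; rule refl inverse)
  have [simp]: "m k54 = k81" "m' k81 = k54"
    using R1[of k54] by (simp_all add: peel)
  obtain k82 where [simp]: "w k7 = k82" "w' k82 = k7"
    by (rule that; rule refl inverse)
  have [simp]: "m' k82 = k68" "m k68 = k82"
    using R4[of k82] by (simp_all add: peel)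
  obtain k83 k84 k85 k86 where [simp]:
    "w' k69 = k83" "w k83 = k69" "m k39 = k84" "m' k84 = k39"
    "w k84 = k85" "w' k85 = k84" "m' k85 = k86" "m k86 = k85"
    by (rule that; rule refl inverse)
  obtain k87 k88 where [simp]: "w k49 = k87" "w' k87 = k49" "w k24 = k88" "w' k88 = k24"
    by (rule that; rule refl inverse)
  have [simp]: "m k88 = k20" "m' k20 = k88"
    using R4[of k18] by (simp_all add: peel)
  have [simp]: "m k37 = k33" "m' k33 = k37"
    using R3[of k23] by (simp_all add: peel)
  have [simp]: "m k42 = k9" "m' k9 = k42"
    using R4[of k23] by (simp_all add: peel)
  have [simp]: "m k9 = k29" "m' k29 = k9"
    using R1[of k29] by (simp_all add: peel)
  have [simp]: "m k38 = k37" "m' k37 = k38"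
    using R1[of k33] by (simp_all add: peel)
  obtain k89 where [simp]: "m' k88 = k89" "m k89 = k88"
    by (rule that; rule refl inverse)
  have [simp]: "m k20 = k89" "m' k89 = k20"
    using R1[of k20] by (simp_all add: peel)
  obtain k90 where [simp]: "m' k86 = k90" "m k90 = k86"
    by (rule that; rule refl inverse)
  have [simp]: "m k85 = k90" "m' k90 = k85"
    using R1[of k85] by (simp_all add: peel)
  obtain k91 k92 where [simp]: "w k90 = k91" "w' k91 = k90" "m' k68 = k92" "m k92 = k68"
    by (rule that; rule refl inverse)
  have [simp]: "m k82 = k92" "m' k92 = k82"
    using R1[of k92] by (simp_all add: peel)
  have [simp]: "w k1 = k92" "w' k92 = k1"
    using R3[of k92] by (simp_all add: peel)
  have [simp]: "w k82 = k17" "w' k17 = k82"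
    using R4[of k92] by (simp_all add: peel)
  have [simp]: "w k3 = k1" "w' k1 = k3"
    using R4[of k34] by (simp_all add: peel)
  have [simp]: "w k74 = k16" "w' k16 = k74"
    using R2[of k16] by (simp_all add: peel)
  have [simp]: "w k23 = k68" "w' k68 = k23"
    using R3[of k5] by (simp_all add: peel)
  have [simp]: "w k34 = k35" "w' k35 = k34"
    using R3[of k35] by (simp_all add: peel)
  have [simp]: "w k43 = k33" "w' k33 = k43"
    using R2[of k42] by (simp_all add: peel)
  have [simp]: "w k92 = k46" "w' k46 = k92"
    using R4[of k68] by (simp_all add: peel)
  have [simp]: "w k48 = k40" "w' k40 = k48"
    using R2[of k4] by (simp_all add: peel)
  have [simp]: "w k57 = k80" "w' k80 = k57"
    using R4[of k50] by (simp_all add: peel)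
  have [simp]: "w k81 = k62" "w' k62 = k81"
    using R4[of k60] by (simp_all add: peel)
  obtain k93 where [simp]: "m k84 = k93" "m' k93 = k84"
    by (rule that; rule refl inverse)
  have [simp]: "m k93 = k39" "m' k39 = k93"
    using R1[of k84] by (simp_all add: peel)
  have [simp]: "w k89 = k93" "w' k93 = k89"
    using R4[of k88] by (simp_all add: peel)
  have [simp]: "w k75 = k20" "w' k20 = k75"
    using R3[of k38] by (simp_all add: peel)
  have [simp]: "m' k91 = k75" "m k75 = k91"
    using R4[of k93] by (simp_all add: peel)
  have [simp]: "w k88 = k44" "w' k44 = k88"
    using R4[of k33] by (simp_all add: peel)
  have [simp]: "m k91 = k74" "m' k74 = k91"
    using R1[of k75] by (simp_all add: peel)
  have [simp]: "w k69 = k39" "w' k39 = k69"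
    using R3[of k91] by (simp_all add: peel)
  have [simp]: "w k79 = k86" "w' k86 = k79"
    using R4[of k16] by (simp_all add: peel)
  obtain k94 where [simp]: "m k31 = k94" "m' k94 = k31"
    by (rule that; rule refl inverse)
  have [simp]: "m k94 = k30" "m' k30 = k94"
    using R1[of k31] by (simp_all add: peel)
  obtain k95 k96 where [simp]: "m k10 = k95" "m' k95 = k10" "m k95 = k96" "m' k96 = k95"
    by (rule that; rule refl inverse)
  have [simp]: "m k96 = k10" "m' k10 = k96"
    using R1[of k10] by (simp_all add: peel)
  obtain k97 where [simp]: "w' k96 = k97" "w k97 = k96"
    by (rule that; rule refl inverse)
  have [simp]: "m k26 = k97" "m' k97 = k26"
    using R3[of k9] by (simp_all add: peel)
  have [simp]: "m k97 = k25" "m' k25 = k97"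
    using R1[of k26] by (simp_all add: peel)
  have [simp]: "w k95 = k65" "w' k65 = k95"
    using R4[of k96] by (simp_all add: peel)
  have [simp]: "w k28 = k49" "w' k49 = k28"
    using R3[of k32] by (simp_all add: peel)
  have [simp]: "w k45 = k25" "w' k25 = k45"
    using R4[of k9] by (simp_all add: peel)
  have [simp]: "w k26 = k94" "w' k94 = k26"
    using R3[of k25] by (simp_all add: peel)
  have [simp]: "w k31 = k89" "w' k89 = k31"
    using R4[of k44] by (simp_all add: peel)
  have [simp]: "w k38 = k30" "w' k30 = k38"
    using R3[of k89] by (simp_all add: peel)
  have [simp]: "w k87 = k83" "w' k83 = k87"
    using R2[of k28] by (simp_all add: peel)
  obtain k98 k99 k100 where [simp]:
    "w k53 = k98" "w' k98 = k53" "m' k98 = k99" "m k99 = k98"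
    "m' k59 = k100" "m k100 = k59"
    by (rule that; rule refl inverse)
  have [simp]: "m k60 = k100" "m' k100 = k60"
    using R1[of k59] by (simp_all add: peel)
  have [simp]: "w k51 = k100" "w' k100 = k51"
    using R3[of k50] by (simp_all add: peel)
  have [simp]: "w k56 = k52" "w' k52 = k56"
    using R4[of k58] by (simp_all add: peel)
  obtain k101 where [simp]: "m k53 = k101" "m' k101 = k53"
    by (rule that; rule refl inverse)
  have [simp]: "w k101 = k77" "w' k77 = k101"
    using R4[of k47] by (simp_all add: peel)
  have [simp]: "m k101 = k63" "m' k63 = k101"
    using R1[of k53] by (simp_all add: peel)
  obtain k102 where [simp]: "m k66 = k102" "m' k102 = k66"
    by (rule that; rule refl inverse)
  have [simp]: "m k102 = k55" "m' k55 = k102"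
    using R1[of k102] by (simp_all add: peel)
  have [simp]: "w k100 = k102" "w' k102 = k100"
    using R3[of k102] by (simp_all add: peel)
  obtain k103 where [simp]: "m' k67 = k103" "m k103 = k67"
    by (rule that; rule refl inverse)
  have [simp]: "m k14 = k103" "m' k103 = k14"
    using R1[of k14] by (simp_all add: peel)
  obtain k104 k105 where [simp]: "w k103 = k104" "w' k104 = k103" "m' k62 = k105" "m k105 = k62"
    by (rule that; rule refl inverse)
  have [simp]: "m k61 = k105" "m' k105 = k61"
    using R1[of k61] by (simp_all add: peel)
  have [simp]: "w k73 = k105" "w' k105 = k73"
    using R4[of k105] by (simp_all add: peel)
  obtain k106 k107 k108 where [simp]:
    "w k105 = k106" "w' k106 = k105" "w' k63 = k107" "w k107 = k63"
    "m' k6 = k108" "m k108 = k6"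
    by (rule that; rule refl inverse)
  have [simp]: "m k7 = k108" "m' k108 = k7"
    using R1[of k6] by (simp_all add: peel)
  have [simp]: "w k58 = k108" "w' k108 = k58"
    using R4[of k46] by (simp_all add: peel)
  have [simp]: "w k6 = k51" "w' k51 = k6"
    using R3[of k51] by (simp_all add: peel)
  have [simp]: "w k102 = k11" "w' k11 = k102"
    using R2[of k100] by (simp_all add: peel)
  have [simp]: "m k47 = k13" "m' k13 = k47"
    using R4[of k40] by (simp_all add: peel)
  have [simp]: "m k13 = k52" "m' k52 = k13"
    using R1[of k13] by (simp_all add: peel)
  obtain k109 where [simp]: "w k108 = k109" "w' k109 = k108"
    by (rule that; rule refl inverse)
  have [simp]: "m k109 = k76" "m' k76 = k109"
    using R4[of k6] by (simp_all add: peel)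
  have [simp]: "m k77 = k109" "m' k109 = k77"
    using R1[of k76] by (simp_all add: peel)
  have [simp]: "w k109 = k67" "w' k67 = k109"
    using R3[of k77] by (simp_all add: peel)
  have [simp]: "w k77 = k57" "w' k57 = k77"
    using R4[of k109] by (simp_all add: peel)
  have [simp]: "m k104 = k107" "m' k107 = k104"
    using R4[of k63] by (simp_all add: peel)
  have [simp]: "w k50 = k76" "w' k76 = k50"
    using R3[of k57] by (simp_all add: peel)
  have [simp]: "w k98 = k55" "w' k55 = k98"
    using R2[of k98] by (simp_all add: peel)
  have [simp]: "m k98 = k15" "m' k15 = k98"
    using R3[of k98] by (simp_all add: peel)
  have [simp]: "w k62 = k99" "w' k99 = k62"
    using R3[of k105] by (simp_all add: peel)
  have [simp]: "w k72 = k70" "w' k70 = k72"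
    using R4[of k15] by (simp_all add: peel)
  have [simp]: "w k86 = k73" "w' k73 = k86"
    using R4[of k70] by (simp_all add: peel)
  have [simp]: "w k12 = k61" "w' k61 = k12"
    using R4[of k55] by (simp_all add: peel)
  have [simp]: "m' k106 = k64" "m k64 = k106"
    using R4[of k49] by (simp_all add: peel)
  have [simp]: "m k106 = k65" "m' k65 = k106"
    using R1[of k65] by (simp_all add: peel)
  have [simp]: "w k106 = k36" "w' k36 = k106"
    using R4[of k65] by (simp_all add: peel)
  \<comment> \<open>Tracing this relation from both ends meets at two names for one point, so it
    yields a coincidence instead of an entry.\<close>
  have e1 [simp]: "k109 = k40"
    using R5[of k109] by (simp add: peel)
  \<comment> \<open>Coincidences spread by comparing the images of identified points under the same
    letter.\<close>
  have e2 [simp]: "k108 = k48"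
    using \<open>w' k109 = k108\<close> \<open>w' k40 = k48\<close> by (simp only: e1)
  have e3 [simp]: "k76 = k41"
    using \<open>m k109 = k76\<close> \<open>m k40 = k41\<close> by (simp only: e1)
  \<comment> \<open>Entries of a merged point are restated for the surviving name.\<close>
  have [simp]: "w' k41 = k50"
    using \<open>w' k76 = k50\<close> by (simp only: e3)
  have [simp]: "w k50 = k41"
    by (simp add: peel)
  have e4 [simp]: "k77 = k46"
    using \<open>m' k109 = k77\<close> \<open>m' k40 = k46\<close> by (simp only: e1)
  have e5 [simp]: "k50 = k6"
    using \<open>m k108 = k6\<close> \<open>m k48 = k50\<close> by (simp only: e2)
  have e6 [simp]: "k51 = k7"
    using \<open>m' k108 = k7\<close> \<open>m' k48 = k51\<close> by (simp only: e2)
  have [simp]: "m k7 = k48"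
    using \<open>m k51 = k48\<close> by (simp only: e6)
  have [simp]: "m' k48 = k7"
    by (simp add: peel)
  have e7 [simp]: "k58 = k47"
    using \<open>w' k108 = k58\<close> \<open>w' k48 = k47\<close> by (simp only: e2)
  have e8 [simp]: "k57 = k47"
    using \<open>w k77 = k57\<close> \<open>w k46 = k47\<close> by (simp only: e4)
  have e9 [simp]: "k54 = k5"
    using \<open>w' k50 = k54\<close> \<open>w' k6 = k5\<close> by (simp only: e5)
  have e10 [simp]: "k41 = k7"
    using \<open>w k50 = k41\<close> \<open>w k6 = k51\<close> by (simp only: e5 e6)
  have e11 [simp]: "k100 = k82"
    using \<open>w k51 = k100\<close> \<open>w k7 = k82\<close> by (simp only: e6)
  have e12 [simp]: "k59 = k46"
    using \<open>w' k58 = k59\<close> \<open>w' k47 = k46\<close> by (simp only: e7)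
  have e13 [simp]: "k80 = k48"
    using \<open>w k57 = k80\<close> \<open>w k47 = k48\<close> by (simp only: e8)
  have e14 [simp]: "k48 = k4"
    using \<open>m' k54 = k80\<close> \<open>m' k5 = k4\<close> by (simp only: e9 e13)
  have e15 [simp]: "k46 = k4"
    using \<open>m k41 = k46\<close> \<open>m k7 = k48\<close> by (simp only: e10 e14)
  have [simp]: "w' k4 = k92"
    using \<open>w' k46 = k92\<close> by (simp only: e15)
  have [simp]: "w k92 = k4"
    by (simp add: peel)
  have e16 [simp]: "k92 = k4"
    using \<open>m k100 = k59\<close> \<open>m k82 = k92\<close> by (simp only: e11 e12 e15)
  have e17 [simp]: "k4 = k1"
    using \<open>w' k92 = k1\<close> \<open>w' k4 = k92\<close> by (simp only: e16)
  have e18 [simp]: "k2 = k1"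
    using \<open>w k92 = k4\<close> \<open>w k4 = k2\<close> by (simp only: e16 e17)
  have [simp]: "m' k1 = k"
    using \<open>m' k2 = k\<close> by (simp only: e18)
  have [simp]: "m k = k1"
    by (simp add: peel)
  have e19 [simp]: "k1 = k"
    using \<open>m k2 = k1\<close> \<open>m k1 = k\<close> by (simp only: e18)
  have [simp]: "m' k = k"
    using \<open>m' k1 = k\<close> by (simp only: e19)
  have [simp]: "m k = k"
    by (simp add: peel)
  show ?thesis
    by simp
qed

section \<open>Elements of order 4\<close>

context two_three_group
begin

text \<open>The bound on orders is applied to \<open>inv v\<close> times the involution
  \<open>a \<otimes> inv m\<close>, a product equal to \<open>v \<otimes> inv m\<close>. Its eighth
  or ninth power is trivial; in the latter case even \<open>n = m\<close>.\<close>

lemma order_4_commutes_conj_order_3: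
  assumes v: "v \<in> carrier G" and a: "involution G (v \<otimes> v)"
    and m: "m \<in> carrier G" "m [^] (3::nat) = \<one>" and i: "v \<otimes> v \<otimes> m \<otimes> (v \<otimes> v) = inv m"
  shows "m \<otimes> (inv v \<otimes> m \<otimes> v) = inv v \<otimes> m \<otimes> v \<otimes> m"
proof (cases "m = \<one>")
  case False
  define a where "a = v \<otimes> v"
  have a: "involution G a"
    using a by (simp add: a_def)
  have i: "a \<otimes> m \<otimes> a = inv m"
    using i by (simp add: a_def)
  define n where "n = inv v \<otimes> m \<otimes> v"
  have n: "n \<in> carrier G" "n [^] (3::nat) = \<one>"
    using v m by (simp_all add: n_def pow_conj)
  have va: "a \<otimes> v = v \<otimes> a" "inv v = a \<otimes> v"
    using v by (simp_all add: a_def m_assoc) (metis a a_def involution_cancel(3) inv_mult_group m_assoc m_closed inv_closed l_inv r_one)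
  have m9: "m [^] (9::nat) = \<one>"
  proof -
    have "m [^] (9::nat) = (m [^] (3::nat)) [^] (3::nat)"
      using m(1) by (simp add: nat_pow_pow)
    then show ?thesis
      by (simp add: m(2))
  qed
  note [simp] = involution_cancel[OF a] inverted_commute[OF a m(1) i] order_3_inv[OF m] va
  have v4: "v \<otimes> v = a" "y \<in> carrier G \<Longrightarrow> v \<otimes> (v \<otimes> y) = a \<otimes> y" for y
    using v by (simp_all add: a_def m_assoc)
  have av [simp]: "y \<in> carrier G \<Longrightarrow> a \<otimes> (v \<otimes> y) = v \<otimes> (a \<otimes> y)" for y
    using v va(1) by (simp add: commute_left)
  have in': "a \<otimes> n \<otimes> a = inv n"
  proof -
    have "a \<otimes> n \<otimes> a = inv v \<otimes> (a \<otimes> m \<otimes> a) \<otimes> v"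
      using v m by (simp add: n_def m_assoc)
    then show ?thesis
      using v m by (simp only: i) (simp add: n_def word_simps del: va)
  qed
  have m': "involution G (a \<otimes> inv m)"
    using m m9 by (intro involution_mult_inverted[OF a]) (simp_all add: nat_pow_inv m_assoc)
  have v4_one: "inv v [^] (4::nat) = \<one>"
    using v by (simp add: numeral_eq_Suc m_assoc v4)
  have "ord (inv v) \<le> 4"
    by (rule ord_le_4I[OF _ v4_one]) (use v in auto)
  then have "(inv v \<otimes> (a \<otimes> inv m)) [^] (8::nat) = \<one> \<or> (inv v \<otimes> (a \<otimes> inv m)) [^] (9::nat) = \<one>"
    using v ord_involution_le_4[OF m'] involution_cancel(1)[OF m'] by (intro pow_8_or_9) auto
  moreover have "inv v \<otimes> (a \<otimes> inv m) = v \<otimes> inv m"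
    using v m by (simp add: m_assoc)
  \<comment> \<open>The fourth power of \<open>v m\<^sup>-\<^sup>1\<close> is the commutator of \<open>n\<close> and \<open>m\<close>, a product of two elements of order 3,
    so order 8 would give a copy of \<open>A\<^sub>4\<close>; order 9 gives the relations of \<open>PSL\<^sub>2(17)\<close> for \<open>m\<close> and \<open>m\<^sup>-\<^sup>1v\<close>.\<close>
  ultimately consider (8) "(v \<otimes> inv m) [^] (8::nat) = \<one>" | (9) "(v \<otimes> inv m) [^] (9::nat) = \<one>"
    by auto
  then show ?thesis
  proof cases
    case 8
    have "(v \<otimes> inv m) [^] (4::nat) = n \<otimes> (m \<otimes> inv n \<otimes> inv m)"
      using v m by (simp add: numeral_eq_Suc n_def m_assoc inv_mult_group)
    moreover have "(v \<otimes> inv m) [^] (8::nat) = ((v \<otimes> inv m) [^] (4::nat)) [^] (2::nat)"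
      using v m by (simp add: nat_pow_pow)
    moreover have "(m \<otimes> inv n \<otimes> inv m) [^] (3::nat) = \<one>"
      using pow_conj[of "inv n" "inv m" 3] m n by (simp add: nat_pow_inv)
    ultimately have "n \<otimes> (m \<otimes> inv n \<otimes> inv m) = \<one>"
      using 8 m n by (intro no_alternating_group_4) auto
    then have "n \<otimes> (m \<otimes> inv n \<otimes> inv m) \<otimes> (m \<otimes> n) = m \<otimes> n"
      using m n by simp
    then show ?thesis
      using m n by (simp add: word_simps n_def[symmetric] del: va)
  next
    case 9
    define w where "w = inv m \<otimes> v"
    have w: "w \<in> carrier G" "m \<otimes> w = v"
      using v m by (simp_all add: w_def word_simps)
    have w9: "w [^] (9::nat) = \<one>"
    proof -
      have "w = inv m \<otimes> (v \<otimes> inv m) \<otimes> m"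
        using v m by (simp add: w_def word_simps)
      then show ?thesis
        using v m 9 by (simp add: pow_conj)
    qed
    let ?m = "conj_action m" and ?m' = "conj_action (inv m)"
      and ?w = "conj_action w" and ?w' = "conj_action (inv w)"
    have "?m w = w"
    \<comment> \<open>The base point of the enumeration is \<open>w\<close> itself, fixed under its
      own conjugation; the conclusion says that \<open>m\<close> commutes with
      \<open>w\<close>.\<close>
    proof (rule PSL_2_17_relations_collapse[of ?m' ?m ?w' ?w])
      show "?m' (?m x) = x" "?m (?m' x) = x" "?w' (?w x) = x" "?w (?w' x) = x" for x
        using m w by (auto simp: conj_action_def word_simps)
      show "?m (?m (?m x)) = x" for x
        using m by (auto simp: conj_action_def word_simps del: va)
      show "(?w ^^ 9) x = x" for x
        using w w9 by (simp add: conj_action_pow conj_action_one)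
      have "(m \<otimes> w) [^] (4::nat) = \<one>"
        unfolding w using v by (simp add: numeral_eq_Suc m_assoc v4)
      then show "((?w \<circ> ?m) ^^ 4) x = x" for x
        using m w(1) by (simp only: conj_action_mult conj_action_pow m_closed) (simp add: conj_action_one)
      \<comment> \<open>The base is \<open>inv m \<otimes> inv m \<otimes> v \<otimes> v = m
        \<otimes> a\<close>, which squares to \<open>\<one>\<close> because \<open>a\<close> inverts
        \<open>m\<close>.\<close>
      have "(inv m \<otimes> (w \<otimes> (m \<otimes> w))) [^] (2::nat) = \<one>"
        unfolding w unfolding w_def using m v by (simp add: numeral_eq_Suc m_assoc v4)
      then show "((?w \<circ> ?m \<circ> ?w \<circ> ?m') ^^ 2) x = x" for x
        using m w(1) by (simp only: conj_action_mult conj_action_pow m_closed inv_closed m_assoc) (simp add: conj_action_one)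
      have n9: "inv n [^] (9::nat) = \<one>"
        using m m9 v by (simp add: n_def pow_conj nat_pow_inv del: va)
      have "involution G (a \<otimes> inv n)"
        using n n9 by (intro involution_mult_inverted[OF a]) (simp_all add: m_assoc inverted_commute[OF a n(1) in'])
      then have "((a \<otimes> inv m) \<otimes> (a \<otimes> inv n)) [^] (9::nat) = \<one>"
        by (rule involution_prod_pow_9[OF m'])
      \<comment> \<open>Here \<open>v \<otimes> inv m \<otimes> inv v = n\<close>, since conjugation
        by \<open>v\<close> and by \<open>inv v\<close> differ by \<open>a\<close>, which inverts
        \<open>n\<close>.\<close>
      moreover have "m \<otimes> (w \<otimes> (m \<otimes> (w \<otimes> (w \<otimes> w)))) = (a \<otimes> inv m) \<otimes> (a \<otimes> inv n)"
        using v m by (simp add: w_def n_def m_assoc cancel_inv_left v4 inv_mult_group)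
      ultimately have "(m \<otimes> (w \<otimes> (m \<otimes> (w \<otimes> (w \<otimes> w))))) [^] (9::nat) = \<one>"
        by simp
      then show "((?w \<circ> ?w \<circ> ?w \<circ> ?m \<circ> ?w \<circ> ?m) ^^ 9) x = x" for x
        using m w(1) by (simp only: conj_action_mult conj_action_pow m_closed inv_closed m_assoc) (simp add: conj_action_one)
      show "?w w = w"
        using w by (simp add: conj_action_fixes)
    qed
    then have "m \<otimes> w = w \<otimes> m"
      using m w by (simp add: conj_action_fixes)
    then have "v = w \<otimes> m"
      using w by simp
    then have "m \<otimes> v = v \<otimes> m"
      using m w by (metis m_assoc)
    then have "n = m"
      using m v by (simp add: n_def m_assoc inv_cancel_left del: va)
    then show ?thesis
      by (simp add: n_def del: va)
  qed
qed (use v in simp)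

text \<open>If \<open>r = h [^] 3\<close> is nontrivial, it commutes with its conjugate
  \<open>s\<close> by the case of order 3. The centralizer of \<open>r\<close> is abelian and
  contains \<open>h\<close> and \<open>s\<close>, so these commute. Conjugating back puts
  \<open>v \<otimes> h \<otimes> inv v\<close> into that centralizer, hence it commutes with
  \<open>h\<close>.\<close>

lemma order_4_commutes_conj:
  assumes v: "v \<in> carrier G" and a: "involution G (v \<otimes> v)"
    and h: "h \<in> carrier G" "h [^] (9::nat) = \<one>" and i: "v \<otimes> v \<otimes> h \<otimes> (v \<otimes> v) = inv h"
  shows "h \<otimes> (inv v \<otimes> h \<otimes> v) = inv v \<otimes> h \<otimes> v \<otimes> h"
proof -
  define r where "r = h [^] (3::nat)"
  have r: "r \<in> carrier G" "r [^] (3::nat) = \<one>"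
    using h by (simp_all add: r_def nat_pow_pow)
  have ir: "v \<otimes> v \<otimes> r \<otimes> (v \<otimes> v) = inv r"
    unfolding r_def by (rule inverted_pow[OF a h(1) i])
  show ?thesis
  proof (cases "r = \<one>")
    case True
    then show ?thesis
      using order_4_commutes_conj_order_3[OF v a h(1) _ i] by (simp add: r_def)
  next
    case False
    define s where "s = inv v \<otimes> r \<otimes> v"
    have s: "s \<in> carrier G"
      using v r by (simp add: s_def)
    have rs: "s \<otimes> r = r \<otimes> s"
      unfolding s_def by (rule order_4_commutes_conj_order_3[OF v a r ir, symmetric])
    have hr: "h \<otimes> r = r \<otimes> h"
      unfolding r_def using h(1) by (simp add: group_commutes_pow)
    have "h \<otimes> s = s \<otimes> h"
      by (rule order_3_centralizer_comm[OF a r(1) False r(2) ir h(1) hr s rs])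
    moreover have "v \<otimes> s \<otimes> inv v = r"
      using v r(1) by (simp add: s_def word_simps)
    ultimately have vhr: "v \<otimes> h \<otimes> inv v \<otimes> r = r \<otimes> (v \<otimes> h \<otimes> inv v)"
      using commute_conj[of h s "inv v"] v h(1) s by simp
    have "v \<otimes> h \<otimes> inv v \<otimes> h = h \<otimes> (v \<otimes> h \<otimes> inv v)"
      by (rule order_3_centralizer_comm[OF a r(1) False r(2) ir _ vhr h(1) hr]) (use v h(1) in simp)
    then have "inv v \<otimes> (v \<otimes> h \<otimes> inv v) \<otimes> v \<otimes> (inv v \<otimes> h \<otimes> v) = inv v \<otimes> h \<otimes> v \<otimes> (inv v \<otimes> (v \<otimes> h \<otimes> inv v) \<otimes> v)"
      using v h(1) by (intro commute_conj) simp_all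
    moreover have "inv v \<otimes> (v \<otimes> h \<otimes> inv v) \<otimes> v = h"
      using v h(1) by (simp add: word_simps)
    ultimately show ?thesis
      by simp
  qed
qed

section \<open>Square roots of involutions and products of three involutions\<close>

lemma involution_square_root_cases:
  assumes a: "involution G a"
  shows "(\<exists>v \<in> carrier G. v \<otimes> v = a) \<or> (\<forall>c \<in> carrier G. c \<otimes> a = a \<otimes> c \<longrightarrow> c = \<one> \<or> c = a)"
proof -
  have "\<exists>v \<in> carrier G. v \<otimes> v = a" if c: "c \<in> carrier G" "c \<otimes> a = a \<otimes> c" "c \<noteq> \<one>" "c \<noteq> a" for c
  proof -
    obtain k where k: "ord c = 2 ^ k"
      using centralizer_two_power[OF a c(1,2)] by blast
    have "k \<noteq> 0"
      using k c ord_eq_1[OF c(1)] by auto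
    moreover have "k \<noteq> 1"
      using k c involution_unique[OF a, of c] by (auto simp: involution_def)
    ultimately obtain l where "k = Suc (Suc l)"
      by (metis One_nat_def not0_implies_Suc)
    then have l: "ord c = 4 * 2 ^ l"
      by (simp add: k)
    have "involution G (c [^] (ord c div 2))"
      using l by (intro involution_in_powers c) simp
    moreover have "c [^] (ord c div 2) \<otimes> a = a \<otimes> c [^] (ord c div 2)"
      using c involution_cancel(1)[OF a] by (intro group_commutes_pow) auto
    ultimately have "c [^] (ord c div 2) = a"
      by (rule involution_unique[OF a])
    \<comment> \<open>Half of \<open>ord c = 4 * 2 ^ l\<close> is twice \<open>2 ^ l\<close>, so
      this power of \<open>c\<close> is the square root sought.\<close>
    then have "c [^] (2 ^ l::nat) \<otimes> c [^] (2 ^ l::nat) = a"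
      using c by (simp add: l nat_pow_mult mult_2)
    then show ?thesis
      using c by blast
  qed
  then show ?thesis
    by blast
qed

text \<open>
  Below, \<open>h\<close> and \<open>n = v\<^sup>-\<^sup>1hv\<close> generate an abelian group on which \<open>v\<close> acts as a square root of \<open>-1\<close>;
  additively, conjugating \<open>v\<^sup>-\<^sup>1\<close> by \<open>w\<close> multiplies it by \<open>(1 + v) w\<close>, and \<open>w = (1 - v) h\<close> solves
  \<open>(1 + v) w = 2 h\<close>.
\<close>
lemma square_root_mult_conj:
  assumes v: "v \<in> carrier G" and a: "involution G (v \<otimes> v)" and g: "g \<in> carrier G"
  shows "involution G (v \<otimes> (inv g \<otimes> v \<otimes> g))"
proof -
  define h where "h = (inv g \<otimes> (v \<otimes> v) \<otimes> g \<otimes> (v \<otimes> v)) [^] (4::nat)"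
  note dec = centralizer_inverted_decomposition[OF a g, folded h_def]
  define n where "n = inv v \<otimes> h \<otimes> v"
  have n: "n \<in> carrier G" "n [^] (9::nat) = \<one>"
    using v dec by (simp_all add: n_def pow_conj)
  have hn: "h \<otimes> n = n \<otimes> h"
    unfolding n_def by (rule order_4_commutes_conj[OF v a dec(1,3,2)])
  have ihn: "inv n \<otimes> h = h \<otimes> inv n"
    by (rule commute_inv[OF hn[symmetric]]) (use n dec in auto)
  have an: "v \<otimes> v \<otimes> n \<otimes> (v \<otimes> v) = inv n"
  proof -
    have "v \<otimes> v \<otimes> n \<otimes> (v \<otimes> v) = inv v \<otimes> (v \<otimes> v \<otimes> h \<otimes> (v \<otimes> v)) \<otimes> v"
      using v dec(1) by (simp add: n_def word_simps)
    then show ?thesis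
      using v dec(1) by (simp only: dec(2)) (simp add: n_def word_simps)
  qed
  define c where "c = g \<otimes> inv h"
  have c: "c \<in> carrier G" "g = c \<otimes> h"
    using g dec(1) by (simp_all add: c_def m_assoc)
  \<comment> \<open>Both elements centralize \<open>v \<otimes> v\<close>, so conjugating
    \<open>v\<close> by \<open>g = c \<otimes> h\<close> is the same as conjugating it by
    \<open>h\<close>.\<close>
  have "c \<otimes> v = v \<otimes> c"
    by (rule centralizer_comm[OF a c(1)]) (use v dec(4) in \<open>simp_all add: m_assoc flip: c_def\<close>)
  moreover have "inv g \<otimes> v \<otimes> g = inv h \<otimes> (inv c \<otimes> (v \<otimes> c)) \<otimes> h"
    using c v dec(1) by (simp add: word_simps)
  ultimately have "inv g \<otimes> v \<otimes> g = inv h \<otimes> v \<otimes> h"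
    using inv_cancel_left[OF c(1) v] by simp
  \<comment> \<open>The product is the involution \<open>v \<otimes> v\<close> times
    \<open>inv n \<otimes> h\<close>, which that involution inverts because \<open>h\<close> and
    \<open>n\<close> commute.\<close>
  then have "v \<otimes> (inv g \<otimes> v \<otimes> g) = (v \<otimes> v) \<otimes> (inv n \<otimes> h)"
    using v dec(1) by (simp add: n_def word_simps)
  moreover have "(inv n \<otimes> h) [^] (9::nat) = \<one>"
    using ihn n dec by (simp add: pow_mult_distrib nat_pow_inv)
  moreover have "(v \<otimes> v) \<otimes> (inv n \<otimes> h) \<otimes> (v \<otimes> v) = inv (inv n \<otimes> h)"
  proof -
    define a where "a = v \<otimes> v"
    have a: "involution G a" "a \<otimes> h \<otimes> a = inv h" "a \<otimes> n \<otimes> a = inv n"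
      using a an dec(2) by (simp_all add: a_def)
    note [simp] = inverted_commute[OF a(1) dec(1) a(2)] inverted_commute[OF a(1) n(1) a(3)] involution_cancel[OF a(1)]
    have "a \<otimes> (inv n \<otimes> h) \<otimes> a = n \<otimes> inv h"
      using n dec(1) by (simp add: m_assoc)
    also have "\<dots> = inv (inv n \<otimes> h)"
      using n dec(1) commute_inv[OF hn] by (simp add: inv_mult_group)
    finally show ?thesis
      by (simp add: a_def)
  qed
  ultimately show ?thesis
    using involution_mult_inverted[OF a, of "inv n \<otimes> h"] n dec(1) by simp
qed

text \<open>With \<open>x = v \<otimes> v \<otimes> t\<close> one has
  \<open>v \<otimes> t = inv v \<otimes> x\<close>. If \<open>h\<close> is a square root of
  \<open>x\<close> and \<open>n\<close> its conjugate by \<open>v\<close>, then conjugating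
  \<open>inv v\<close> by \<open>h \<otimes> inv n\<close> contributes exactly the factor
  \<open>h \<otimes> h\<close>.\<close>

lemma square_root_mult_involution:
  assumes v: "v \<in> carrier G" and a: "involution G (v \<otimes> v)" and t: "involution G t"
  shows "\<exists>g \<in> carrier G. v \<otimes> t = inv g \<otimes> inv v \<otimes> g"
proof -
  define x where "x = v \<otimes> v \<otimes> t"
  \<comment> \<open>The exponent 5 is the inverse of 2 modulo 9, so \<open>h\<close> is a square
    root of \<open>x\<close>.\<close>
  define h where "h = x [^] (5::nat)"
  have x: "x \<in> carrier G" "x [^] (9::nat) = \<one>" "v \<otimes> v \<otimes> x \<otimes> (v \<otimes> v) = inv x"
    using involution_prod_pow_9[OF a t] involution_prod_inverted(1)[OF a t] v involution_cancel(1)[OF t]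
    by (simp_all add: x_def)
  have h: "h \<in> carrier G" "v \<otimes> v \<otimes> h \<otimes> (v \<otimes> v) = inv h"
    using inverted_pow[OF a x(1,3)] x(1) by (simp_all add: h_def)
  have h9: "h [^] (9::nat) = \<one>"
  proof -
    have "h [^] (9::nat) = (x [^] (9::nat)) [^] (5::nat)"
      using x(1) by (simp add: h_def nat_pow_pow)
    then show ?thesis
      by (simp add: x(2))
  qed
  have "h \<otimes> h = x [^] (9::nat) \<otimes> x"
    using x(1) by (simp add: h_def nat_pow_mult flip: nat_pow_Suc)
  then have hh: "h \<otimes> h = x"
    using x by simp
  define n where "n = inv v \<otimes> h \<otimes> v"
  have n: "n \<in> carrier G"
    using v h by (simp add: n_def)
  have hn: "h \<otimes> n = n \<otimes> h"
    unfolding n_def by (rule order_4_commutes_conj[OF v a h(1) h9 h(2)])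
  have "inv h \<otimes> inv v = inv v \<otimes> n"
  proof -
    have "n \<otimes> v = inv v \<otimes> (h \<otimes> (v \<otimes> v))"
      using h(1) v by (simp add: n_def m_assoc)
    also have "h \<otimes> (v \<otimes> v) = v \<otimes> v \<otimes> inv h"
      by (rule inverted_commute(2)[OF a h, symmetric])
    finally have "inv v \<otimes> (n \<otimes> v) \<otimes> inv v = inv v \<otimes> (v \<otimes> inv h) \<otimes> inv v"
      using h(1) v by (simp add: word_simps)
    then show ?thesis
      using h(1) v n by (simp add: word_simps)
  qed
  then have "inv (h \<otimes> inv n) \<otimes> inv v \<otimes> (h \<otimes> inv n) = n \<otimes> (inv v \<otimes> n) \<otimes> h \<otimes> inv n"
    using h n v by (simp add: inv_mult_group m_assoc)
  also have "n \<otimes> inv v = inv v \<otimes> h"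
    using h v by (simp add: n_def m_assoc)
  then have "n \<otimes> (inv v \<otimes> n) \<otimes> h \<otimes> inv n = inv v \<otimes> h \<otimes> (n \<otimes> h) \<otimes> inv n"
    using h n v by (simp flip: m_assoc)
  also have "\<dots> = inv v \<otimes> h \<otimes> h"
    unfolding hn[symmetric] using h n v by (simp add: m_assoc)
  finally have "inv v \<otimes> h \<otimes> h = inv (h \<otimes> inv n) \<otimes> inv v \<otimes> (h \<otimes> inv n)" ..
  moreover have "v \<otimes> t = inv v \<otimes> h \<otimes> h"
    using h v involution_cancel(1)[OF t] by (simp add: m_assoc hh) (simp add: x_def word_simps)
  ultimately show ?thesis
    using h n by (intro bexI[of _ "h \<otimes> inv n"]) auto
qed

text \<open>If \<open>a = v \<otimes> v\<close>, then \<open>v \<otimes> s\<close> is a conjugate of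
  \<open>inv v\<close>, multiplying by \<open>t\<close> leads back to a conjugate of
  \<open>v\<close>, and \<open>v\<close> times that is an involution. If \<open>a\<close> has no
  square root, its centralizer is \<open>{\<one>, a}\<close>, which forces \<open>a\<close> to
  invert \<open>s \<otimes> t\<close>.\<close>

lemma involution_mult_closed:
  assumes a: "involution G a" and s: "involution G s" and t: "involution G t"
  shows "involution G (a \<otimes> s \<otimes> t)"
  using involution_square_root_cases[OF a]
proof
  assume "\<exists>v \<in> carrier G. v \<otimes> v = a"
  then obtain v where v: "v \<in> carrier G" "v \<otimes> v = a"
    by blast
  have v': "involution G (v \<otimes> v)" "involution G (inv v \<otimes> inv v)"
    using a v involution_cancel(3)[OF a] by (simp_all flip: inv_mult_group)
  obtain g where g: "g \<in> carrier G" "v \<otimes> s = inv g \<otimes> inv v \<otimes> g"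
    using square_root_mult_involution[OF v(1) v'(1) s] by blast
  \<comment> \<open>Chosen so that conjugation by \<open>g\<close> can be pulled out of
    \<open>v \<otimes> s \<otimes> t\<close>, leaving \<open>inv v \<otimes> u\<close>;
    \<open>inv v\<close> is also a square root of \<open>a\<close>.\<close>
  define u where "u = inv (inv g) \<otimes> t \<otimes> inv g"
  have u: "involution G u"
    unfolding u_def by (rule involution_conj[OF t]) (use g in simp)
  obtain k where k: "k \<in> carrier G" "inv v \<otimes> u = inv k \<otimes> v \<otimes> k"
    using square_root_mult_involution[OF _ v'(2) u] v by auto
  have "v \<otimes> s \<otimes> t = inv g \<otimes> (inv v \<otimes> u) \<otimes> g"
    using g v involution_cancel(1)[OF t] by (simp add: g(2) u_def word_simps)
  then have "v \<otimes> s \<otimes> t = inv (k \<otimes> g) \<otimes> v \<otimes> (k \<otimes> g)"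
    using g k v by (simp add: k(2) word_simps)
  then have "a \<otimes> s \<otimes> t = v \<otimes> (inv (k \<otimes> g) \<otimes> v \<otimes> (k \<otimes> g))"
    using v s t by (simp add: involution_cancel m_assoc flip: v(2))
  then show ?thesis
    using square_root_mult_conj[OF v(1) v'(1), of "k \<otimes> g"] g k by simp
next
  assume *: "\<forall>c \<in> carrier G. c \<otimes> a = a \<otimes> c \<longrightarrow> c = \<one> \<or> c = a"
  note [simp] = involution_cancel[OF a] involution_cancel[OF s] involution_cancel[OF t]
  define x where "x = s \<otimes> t"
  have x: "x \<in> carrier G" "x [^] (9::nat) = \<one>"
    using involution_prod_pow_9[OF s t] by (simp_all add: x_def)
  define h where "h = (inv x \<otimes> a \<otimes> x \<otimes> a) [^] (4::nat)"
  note dec = centralizer_inverted_decomposition[OF a x(1), folded h_def]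
  have "x \<otimes> inv h = \<one> \<or> x \<otimes> inv h = a"
    using * dec x by simp
  then have "x = h \<or> x = a \<otimes> h"
    using inv_cancel_right[OF dec(1) x(1)] dec(1) by (metis l_one)
  \<comment> \<open>Otherwise \<open>x\<close> would be an involution, against
    \<open>x [^] 9 = \<one>\<close>.\<close>
  moreover have "x \<noteq> a \<otimes> h"
  proof
    assume "x = a \<otimes> h"
    then have inv: "involution G x"
      using involution_mult_inverted[OF a dec(1,2,3)] by simp
    then have "x [^] (2::nat) = \<one>"
      by (simp add: involution_iff numeral_2_eq_2)
    then have "x = \<one>"
      using x by (intro pow_coprime_one[of x 2 9]) simp_all
    then show False
      using inv by (simp add: involution_iff)
  qed
  ultimately have "involution G (a \<otimes> x)"
    using involution_mult_inverted[OF a dec(1,2,3)] by auto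
  then show ?thesis
    by (simp add: x_def m_assoc)
qed

section \<open>The normal complement\<close>

text \<open>This set turns out to be \<open>O_3(G)\<close>. No generated subgroup is taken: closure
  of the involutions under threefold products makes the set itself a subgroup.\<close>

definition involution_products :: "'a set" where
  "involution_products = {s \<otimes> t | s t. involution G s \<and> involution G t}"

lemma involution_productsI:
  "involution G s \<Longrightarrow> involution G t \<Longrightarrow> s \<otimes> t \<in> involution_products"
  by (auto simp: involution_products_def)

lemma involution_productsE:
  assumes "x \<in> involution_products"
  obtains s t where "involution G s" "involution G t" "x = s \<otimes> t"
  using assms by (auto simp: involution_products_def)

lemma involution_products_carrier: "x \<in> involution_products \<Longrightarrow> x \<in> carrier G"
  by (auto simp: involution_products_def involution_iff)

lemma involution_products_pow_9: "x \<in> involution_products \<Longrightarrow> x [^] (9::nat) = \<one>"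
  by (auto simp: involution_products_def involution_prod_pow_9)

text \<open>The involution \<open>a \<otimes> s \<otimes> t\<close> is its own inverse
  \<open>t \<otimes> s \<otimes> a\<close>; multiply by \<open>a\<close> on the right.\<close>

lemma involution_products_inverted:
  assumes a: "involution G a" and x: "x \<in> involution_products"
  shows "a \<otimes> x \<otimes> a = inv x"
proof -
  obtain s t where st: "involution G s" "involution G t" "x = s \<otimes> t"
    using x by (auto simp: involution_products_def)
  note [simp] = involution_cancel[OF a] involution_cancel[OF st(1)] involution_cancel[OF st(2)]
  have "inv (a \<otimes> s \<otimes> t) = a \<otimes> s \<otimes> t"
    by (rule involution_cancel(3)[OF involution_mult_closed[OF a st(1,2)]])
  then have *: "t \<otimes> (s \<otimes> a) = a \<otimes> (s \<otimes> t)"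
    by (simp add: inv_mult_group m_assoc)
  have "a \<otimes> x \<otimes> a = t \<otimes> (s \<otimes> a) \<otimes> a"
    by (simp add: * st m_assoc)
  then show ?thesis
    by (simp add: st inv_mult_group m_assoc)
qed

lemma exists_involution: "\<exists>a. involution G a"
proof -
  have "2 \<in> element_order_primes G"
    by (simp add: primes)
  then obtain g where "g \<in> carrier G" "even (ord g)"
    by (auto simp: element_order_primes_def)
  then show ?thesis
    using involution_in_powers by blast
qed

text \<open>In a product of four involutions the first three merge into one.\<close>

lemma involution_products_subgroup: "subgroup involution_products G"
proof (rule subgroupI)
  show "involution_products \<subseteq> carrier G"
    using involution_products_carrier by blast
next
  obtain a where a: "involution G a"
    using exists_involution by blast
  then show "involution_products \<noteq> {}"
    using involution_productsI[OF a a] by blast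
next
  fix x assume "x \<in> involution_products"
  then obtain s t where st: "involution G s" "involution G t" "x = s \<otimes> t"
    by (rule involution_productsE)
  then have "inv x = t \<otimes> s"
    by (simp add: inv_mult_group involution_cancel)
  then show "inv x \<in> involution_products"
    using involution_productsI[OF st(2,1)] by simp
next
  fix x y assume "x \<in> involution_products" "y \<in> involution_products"
  then obtain s t u w where *: "involution G s" "involution G t" "x = s \<otimes> t"
    "involution G u" "involution G w" "y = u \<otimes> w"
    by (auto elim!: involution_productsE)
  then have "x \<otimes> y = (s \<otimes> t \<otimes> u) \<otimes> w"
    by (simp add: m_assoc involution_cancel)
  then show "x \<otimes> y \<in> involution_products"
    using involution_productsI[OF involution_mult_closed[OF *(1,2,4)] *(5)] by simp
qed

lemma involution_products_pow: "x \<in> involution_products \<Longrightarrow> x [^] (n::nat) \<in> involution_products"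
  by (induction n) (simp_all add: subgroup.one_closed[OF involution_products_subgroup] subgroup.m_closed[OF involution_products_subgroup])

lemma involution_products_conj:
  assumes "x \<in> involution_products" and g: "g \<in> carrier G"
  shows "inv g \<otimes> x \<otimes> g \<in> involution_products"
proof -
  obtain s t where st: "involution G s" "involution G t" "x = s \<otimes> t"
    using assms(1) by (rule involution_productsE)
  then have "inv g \<otimes> x \<otimes> g = (inv g \<otimes> s \<otimes> g) \<otimes> (inv g \<otimes> t \<otimes> g)"
    using g by (simp add: word_simps involution_cancel)
  then show ?thesis
    using involution_productsI[OF involution_conj[OF st(1) g] involution_conj[OF st(2) g]] by simp
qed

lemma involution_products_normal: "involution_products \<lhd> G"
proof -
  have "g \<otimes> x \<otimes> inv g \<in> involution_products" if "g \<in> carrier G" "x \<in> involution_products" for g x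
    using involution_products_conj[OF that(2), of "inv g"] that by simp
  then show ?thesis
    using involution_products_subgroup by (simp add: normal_inv_iff)
qed

text \<open>A single involution inverts \<open>x\<close>, \<open>y\<close> and
  \<open>x \<otimes> y\<close>.\<close>

lemma involution_products_comm:
  assumes x: "x \<in> involution_products" and y: "y \<in> involution_products"
  shows "x \<otimes> y = y \<otimes> x"
proof -
  obtain a where a: "involution G a"
    using exists_involution by blast
  have xy: "x \<otimes> y \<in> involution_products"
    by (rule subgroup.m_closed[OF involution_products_subgroup x y])
  show ?thesis
    by (rule comm_of_inverted[OF a involution_products_carrier[OF x] involution_products_inverted[OF a x]
          involution_products_carrier[OF y] involution_products_inverted[OF a y] involution_products_inverted[OF a xy]])
qed

text \<open>The inverted factor found before is a power of a product of two involutions, a conjugate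
  of \<open>a\<close> and \<open>a\<close> itself.\<close>

lemma involution_products_decomposition:
  assumes a: "involution G a" and g: "g \<in> carrier G"
  obtains c x where "c \<in> centralizer G a" "x \<in> involution_products" "g = c \<otimes> x"
proof -
  note dec = centralizer_inverted_decomposition[OF a g]
  define h where "h = (inv g \<otimes> a \<otimes> g \<otimes> a) [^] (4::nat)"
  have h: "h \<in> carrier G"
    using dec(1) by (simp add: h_def)
  have "inv g \<otimes> a \<otimes> g \<otimes> a \<in> involution_products"
    by (rule involution_productsI[OF involution_conj[OF a g] a])
  then have "h \<in> involution_products"
    unfolding h_def by (rule involution_products_pow)
  moreover have "g \<otimes> inv h \<in> centralizer G a"
    using dec(4) g h by (simp add: centralizer_def h_def)
  moreover have "g = g \<otimes> inv h \<otimes> h"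
    using g h by (simp add: word_simps)
  ultimately show ?thesis
    using that by blast
qed

lemma involution_products_centralizer_trivial:
  assumes a: "involution G a" and x: "x \<in> involution_products" "x \<otimes> a = a \<otimes> x"
  shows "x = \<one>"
proof -
  note [simp] = involution_cancel[OF a] involution_products_carrier[OF x(1)]
  have "a \<otimes> x \<otimes> a = x"
    using x(2) by (simp add: m_assoc)
  then have "inv x = x"
    using involution_products_inverted[OF a x(1)] by simp
  then have "x [^] (2::nat) = \<one>"
    using r_inv[of x] by (simp add: numeral_2_eq_2)
  then show ?thesis
    by (intro pow_coprime_one[of x 2 9]) (simp_all add: involution_products_pow_9[OF x(1)])
qed

text \<open>Since \<open>a\<close> is a power of \<open>c\<close>, the element \<open>x\<close> is
  both centralized and inverted by \<open>a\<close>, so \<open>x [^] 2 = \<one>\<close>, while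
  \<open>x [^] 9 = \<one>\<close>.\<close>

lemma involution_products_fixed_point_free:
  assumes a: "involution G a" and c: "c \<in> centralizer G a" "c \<noteq> \<one>"
    and x: "x \<in> involution_products" "c \<otimes> x = x \<otimes> c"
  shows "x = \<one>"
proof -
  obtain n :: nat where n: "c [^] n = a"
    using centralizer_power_involution[OF a] c by (auto simp: centralizer_def)
  have "c [^] n \<otimes> x = x \<otimes> c [^] n"
    using c x by (intro group_commutes_pow) (auto simp: centralizer_def involution_products_carrier)
  then show ?thesis
    using involution_products_centralizer_trivial[OF a x(1)] by (simp add: n)
qed

section \<open>Identification with the largest normal 3-subgroup\<close>

lemma involution_products_power_coset:
  assumes c: "c \<in> carrier G" and x: "x \<in> involution_products"
  shows "\<exists>y \<in> involution_products. (c \<otimes> x) [^] (n::nat) = c [^] n \<otimes> y"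
proof (induction n)
  case 0
  then show ?case
    by (intro bexI[of _ \<one>] subgroup.one_closed[OF involution_products_subgroup]) simp
next
  case (Suc n)
  then obtain y where y: "y \<in> involution_products" "(c \<otimes> x) [^] n = c [^] n \<otimes> y"
    by blast
  have "(c \<otimes> x) [^] Suc n = c [^] Suc n \<otimes> (inv c \<otimes> y \<otimes> c \<otimes> x)"
    using c involution_products_carrier[OF x] involution_products_carrier[OF y(1)] by (simp add: y(2) word_simps)
  then show ?case
    using subgroup.m_closed[OF involution_products_subgroup involution_products_conj[OF y(1) c] x] by blast
qed

text \<open>If the centralizing factor \<open>c\<close> of \<open>h\<close> were nontrivial, some
  power of \<open>h\<close> would lie in the coset of \<open>a\<close>, which consists of
  involutions, although \<open>h\<close> has odd order.\<close>

lemma order_power_3_in_involution_products: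
  assumes h: "h \<in> carrier G" "ord h = 3 ^ k"
  shows "h \<in> involution_products"
proof -
  obtain a where a: "involution G a"
    using exists_involution by blast
  obtain c x where cx: "c \<in> centralizer G a" "x \<in> involution_products" "h = c \<otimes> x"
    using involution_products_decomposition[OF a h(1)] .
  have c: "c \<in> carrier G" "c \<otimes> a = a \<otimes> c"
    using cx by (auto simp: centralizer_def)
  have "c = \<one>"
  proof (rule ccontr)
    assume "c \<noteq> \<one>"
    then obtain n :: nat where n: "c [^] n = a"
      using centralizer_power_involution[OF a c] by blast
    obtain y where y: "y \<in> involution_products" "h [^] n = a \<otimes> y"
      using involution_products_power_coset[OF c(1) cx(2), of n] cx(3) n by auto
    have "involution G (h [^] n)"
      unfolding y(2) by (intro involution_mult_inverted[OF a involution_products_carrier[OF y(1)] involution_products_inverted[OF a y(1)] involution_products_pow_9[OF y(1)]])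
    then have "2 dvd ord (h [^] n)"
      by (simp add: involution_def)
    moreover have "ord (h [^] n) dvd 3 ^ k"
    proof -
      have "(h [^] n) [^] (3 ^ k::nat) = (h [^] (3 ^ k::nat)) [^] n"
        using h(1) by (simp add: nat_pow_pow mult.commute)
      also have "\<dots> = \<one>"
        using pow_ord_eq_1[OF h(1)] by (simp add: h(2))
      finally show ?thesis
        using h(1) by (simp add: pow_eq_id)
    qed
    ultimately have "even ((3::nat) ^ k)"
      by (rule dvd_trans)
    then show False
      by simp
  qed
  then show ?thesis
    using cx involution_products_carrier by simp
qed

text \<open>Exponent 9 makes the subgroup a 3-group, and it contains every element whose order is a
  power of 3.\<close>

lemma involution_products_is_O_3: "is_O_p G 3 involution_products"
proof -
  have "is_p_set G 3 involution_products"
    unfolding is_p_set_def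
  proof
    fix x assume x: "x \<in> involution_products"
    then have "ord x dvd 3 ^ 2"
      using involution_products_pow_9[OF x] involution_products_carrier[OF x] by (simp flip: pow_eq_id)
    then show "\<exists>k. ord x = 3 ^ k"
      using divides_primepow_nat[of 3 "ord x" 2] by auto
  qed
  moreover have "H \<subseteq> involution_products" if H: "H \<lhd> G" "is_p_set G 3 H" for H
  proof
    fix x assume x: "x \<in> H"
    then obtain k where "ord x = 3 ^ k"
      using H(2) by (auto simp: is_p_set_def)
    moreover have "x \<in> carrier G"
      using subgroup.mem_carrier[OF normal_imp_subgroup[OF H(1)] x] .
    ultimately show "x \<in> involution_products"
      by (intro order_power_3_in_involution_products)
  qed
  ultimately show ?thesis
    using involution_products_normal by (simp add: is_O_p_def)
qed

section \<open>Local finiteness\<close>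

lemma finite_cyclic: "d \<in> carrier G \<Longrightarrow> finite (generate G {d})"
  using generate_pow_card[of d] ord_pos[of d] card_ge_0_finite by metis

text \<open>Adding one generator at a time multiplies a finite subgroup by a finite cyclic one;
  commutativity keeps the product a subgroup.\<close>

lemma finite_generate_involution_products:
  assumes "finite S" "S \<subseteq> involution_products"
  shows "finite (generate G S)"
proof -
  have "\<exists>P. finite P \<and> subgroup P G \<and> P \<subseteq> involution_products \<and> S \<subseteq> P"
    using assms
  proof (induction S rule: finite_induct)
    case empty
    then show ?case
      using triv_subgroup subgroup.one_closed[OF involution_products_subgroup] by (intro exI[of _ "{\<one>}"]) auto
  next
    case (insert s S)
    then obtain P where P: "finite P" "subgroup P G" "P \<subseteq> involution_products" "S \<subseteq> P"
      by auto
    have s: "s \<in> involution_products" "s \<in> carrier G"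
      using insert involution_products_carrier by auto
    let ?D = "generate G {s}"
    have D: "subgroup ?D G" "s \<in> ?D"
      using s(2) by (simp_all add: generate_is_subgroup generate.incl)
    have DN: "?D \<subseteq> involution_products"
      by (rule generate_subgroup_incl[OF _ involution_products_subgroup]) (use s(1) in simp)
    have "inv k \<otimes> h \<otimes> k = h" if "h \<in> P" "k \<in> ?D" for h k
    proof -
      have "h \<otimes> k = k \<otimes> h"
        using that P(3) DN by (intro involution_products_comm) auto
      moreover have "h \<in> carrier G" "k \<in> carrier G"
        using that subgroup.mem_carrier[OF P(2)] subgroup.mem_carrier[OF D(1)] by auto
      ultimately show ?thesis
        by (simp add: m_assoc inv_cancel_left)
    qed
    then have "subgroup (P <#> ?D) G"
      by (intro subgroup_set_mult P(2) D(1)) simp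
    moreover have "finite (P <#> ?D)"
      by (intro finite_set_mult P(1) finite_cyclic s(2))
    moreover have "P <#> ?D \<subseteq> involution_products"
    proof
      fix y assume "y \<in> P <#> ?D"
      then obtain h k where hk: "h \<in> P" "k \<in> ?D" "y = h \<otimes> k"
        by (auto simp: set_mult_def)
      then show "y \<in> involution_products"
        using subgroup.m_closed[OF involution_products_subgroup subsetD[OF P(3) hk(1)] subsetD[OF DN hk(2)]] by simp
    qed
    moreover have "insert s S \<subseteq> P <#> ?D"
    proof
      fix x assume "x \<in> insert s S"
      then consider "x = s" | "x \<in> P"
        using P(4) by auto
      then show "x \<in> P <#> ?D"
      proof cases
        case 1
        then have "x = \<one> \<otimes> s"
          using s by simp
        then show ?thesis
          unfolding set_mult_def using subgroup.one_closed[OF P(2)] D(2) by blast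
      next
        case 2
        then have "x = x \<otimes> \<one>"
          using subgroup.mem_carrier[OF P(2)] by simp
        then show ?thesis
          unfolding set_mult_def using 2 subgroup.one_closed[OF D(1)] by blast
      qed
    qed
    ultimately show ?case
      by blast
  qed
  then obtain P where "finite P" "subgroup P G" "S \<subseteq> P"
    by blast
  then show ?thesis
    using generate_subgroup_incl[of S P] finite_subset[of "generate G S" P] by simp
qed

text \<open>The centralizing factors of the elements of \<open>F\<close> generate a finite cyclic
  group \<open>D\<close>. The \<open>D\<close>-conjugates of the other factors form a finite
  \<open>D\<close>-invariant set \<open>S\<close>, so \<open>generate G S <#> D\<close> is a finite
  subgroup containing \<open>F\<close>.\<close>

lemma locally_finite: "locally_finite_group G"
  unfolding locally_finite_group_def
proof (intro allI impI, elim conjE)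
  fix F assume F: "finite F" "F \<subseteq> carrier G"
  obtain a where a: "involution G a"
    using exists_involution by blast
  have "\<exists>c x. c \<in> centralizer G a \<and> x \<in> involution_products \<and> f = c \<otimes> x" if "f \<in> F" for f
    using involution_products_decomposition[OF a, of f] that F by blast
  then obtain c x where cx: "\<And>f. f \<in> F \<Longrightarrow> c f \<in> centralizer G a"
    "\<And>f. f \<in> F \<Longrightarrow> x f \<in> involution_products" "\<And>f. f \<in> F \<Longrightarrow> f = c f \<otimes> x f"
    by metis
  have "finite (c ` F)" "c ` F \<subseteq> centralizer G a"
    using F cx(1) by auto
  then obtain d where d: "d \<in> centralizer G a" "generate G (c ` F) = generate G {d}"
    using invol a unfolding locally_cyclic_def by meson
  define D where "D = generate G {d}"
  have dG: "d \<in> carrier G"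
    using d by (simp add: centralizer_def)
  have D: "subgroup D G" "finite D"
    using dG generate_is_subgroup finite_cyclic by (auto simp: D_def)
  have cD: "c f \<in> D" if "f \<in> F" for f
    unfolding D_def d(2)[symmetric] using that by (intro generate.incl) auto
  define S where "S = (\<lambda>(e, f). inv e \<otimes> x f \<otimes> e) ` (D \<times> F)"
  have S: "finite S" "S \<subseteq> involution_products"
    using D F cx(2) subgroup.mem_carrier[OF D(1)] by (auto simp: S_def intro!: involution_products_conj)
  have SG: "S \<subseteq> carrier G"
    using S involution_products_carrier by blast
  have "inv e \<otimes> s \<otimes> e \<in> S" if s: "s \<in> S" and e: "e \<in> D" for s e
  proof -
    obtain e' f where ef: "e' \<in> D" "f \<in> F" "s = inv e' \<otimes> x f \<otimes> e'"
      using s by (auto simp: S_def)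
    then have "inv e \<otimes> s \<otimes> e = inv (e' \<otimes> e) \<otimes> x f \<otimes> (e' \<otimes> e)"
      using e subgroup.mem_carrier[OF D(1)] involution_products_carrier[OF cx(2)] by (simp add: word_simps)
    then show ?thesis
      unfolding S_def using ef e subgroup.m_closed[OF D(1)] by (intro image_eqI[of _ _ "(e' \<otimes> e, f)"]) auto
  qed
  then have "subgroup (generate G S <#> D) G"
    using D subgroup.mem_carrier[OF D(1)]
    by (intro subgroup_set_mult generate_is_subgroup SG generate_conj_closed) auto
  moreover have "F \<subseteq> generate G S <#> D"
  proof
    fix f assume f: "f \<in> F"
    have cG: "c f \<in> carrier G" and xG: "x f \<in> carrier G"
      using cx(1,2)[OF f] involution_products_carrier by (auto simp: centralizer_def)
    \<comment> \<open>Conjugating \<open>x f\<close> by \<open>inv (c f)\<close> exchanges the two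
      factors of \<open>f\<close>; the conjugate lies in \<open>S\<close> because \<open>D\<close>
      is closed under inverses.\<close>
    have "inv (inv (c f)) \<otimes> x f \<otimes> inv (c f) \<in> S"
      unfolding S_def using subgroup.m_inv_closed[OF D(1) cD[OF f]] f
      by (intro image_eqI[of _ _ "(inv (c f), f)"]) auto
    then have "inv (inv (c f)) \<otimes> x f \<otimes> inv (c f) \<otimes> c f \<in> generate G S <#> D"
      unfolding set_mult_def using cD[OF f] generate.incl by fast
    moreover have "inv (inv (c f)) \<otimes> x f \<otimes> inv (c f) \<otimes> c f = c f \<otimes> x f"
      using cG xG by (simp add: word_simps)
    ultimately show "f \<in> generate G S <#> D"
      by (simp only: cx(3)[OF f, symmetric])
  qed
  ultimately have "generate G F \<subseteq> generate G S <#> D"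
    by (intro generate_subgroup_incl)
  then show "finite (generate G F)"
    using finite_set_mult[OF finite_generate_involution_products[OF S] D(2)] finite_subset by blast
qed

end

theorem theorem1:
  fixes G (structure)
  assumes grp: "group G"
    and periodic: "periodic_group G"
    and primes: "element_order_primes G = {2, 3}"
    and ord_prod: "\<forall>g \<in> carrier G. \<forall>h \<in> carrier G.
        group.ord G g \<le> 4 \<and> group.ord G h \<le> 4 \<longrightarrow> group.ord G (g \<otimes> h) \<le> 9"
    and invol: "\<forall>t. involution G t \<longrightarrow>
        locally_cyclic G (centralizer G t) \<and> p_subgroup G 2 (centralizer G t)"
  shows "\<exists>N C. is_O_p G 3 N
            \<and> (\<forall>x \<in> N. \<forall>y \<in> N. x \<otimes> y = y \<otimes> x)
            \<and> (\<forall>x \<in> N. x [^] (9::nat) = \<one>)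
            \<and> locally_cyclic G C \<and> p_subgroup G 2 C
            \<and> N \<inter> C = {\<one>} \<and> N <#> C = carrier G
            \<and> (\<forall>c \<in> C. c \<noteq> \<one> \<longrightarrow> (\<forall>x \<in> N. c \<otimes> x \<otimes> inv c = x \<longrightarrow> x = \<one>))
            \<and> locally_finite_group G"
proof -
  interpret two_three_group G
    using assms by (intro two_three_group.intro two_three_group_axioms.intro)
  obtain a where a: "involution G a"
    using exists_involution by blast
  \<comment> \<open>The centralizer of any involution serves as complement.\<close>
  let ?N = involution_products and ?C = "centralizer G a"
  have C: "locally_cyclic G ?C" "p_subgroup G 2 ?C"
    using invol a by auto
  then have Csub: "subgroup ?C G"
    by (simp add: p_subgroup_def)
  have "?N \<inter> ?C = {\<one>}"
  proof
    show "?N \<inter> ?C \<subseteq> {\<one>}"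
      using involution_products_centralizer_trivial[OF a] by (auto simp: centralizer_def)
    show "{\<one>} \<subseteq> ?N \<inter> ?C"
      using subgroup.one_closed[OF Csub] subgroup.one_closed[OF involution_products_subgroup] by simp
  qed
  moreover have "?N <#> ?C = carrier G"
  proof
    show "?N <#> ?C \<subseteq> carrier G"
      by (intro set_mult_closed subgroup.subset involution_products_subgroup Csub)
    show "carrier G \<subseteq> ?N <#> ?C"
    proof
      fix g assume g: "g \<in> carrier G"
      \<comment> \<open>The decomposition has the centralizing factor on the left; applying it to
        \<open>inv g\<close> and inverting puts \<open>?N\<close> first.\<close>
      obtain c x where cx: "c \<in> ?C" "x \<in> ?N" "inv g = c \<otimes> x"
        by (rule involution_products_decomposition[OF a, of "inv g"]) (use g in simp)
      have "inv (inv g) = inv x \<otimes> inv c"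
        unfolding cx(3) using subgroup.mem_carrier[OF Csub cx(1)] involution_products_carrier[OF cx(2)]
        by (rule inv_mult_group)
      then have "g = inv x \<otimes> inv c"
        using g by simp
      then show "g \<in> ?N <#> ?C"
        unfolding set_mult_def
        using subgroup.m_inv_closed[OF involution_products_subgroup cx(2)] subgroup.m_inv_closed[OF Csub cx(1)] by blast
    qed
  qed
  moreover have "x = \<one>" if c: "c \<in> ?C" "c \<noteq> \<one>" and x: "x \<in> ?N" "c \<otimes> x \<otimes> inv c = x" for c x
  proof -
    have "c \<otimes> x = c \<otimes> x \<otimes> inv c \<otimes> c"
      using subgroup.mem_carrier[OF Csub c(1)] involution_products_carrier[OF x(1)] by (simp add: m_assoc)
    then have "c \<otimes> x = x \<otimes> c"
      by (simp only: x(2))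
    then show ?thesis
      by (rule involution_products_fixed_point_free[OF a c x(1)])
  qed
  ultimately show ?thesis
    using C by (intro exI[of _ ?N] exI[of _ ?C] conjI ballI impI)
      (simp_all add: involution_products_is_O_3 involution_products_comm involution_products_pow_9 locally_finite)
qed

end
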